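(* Let $q\ge 59$ and let $Z$ be a subset of $X$ with $\chi_Z\in V_0\oplus V_2$ and $|Z|=4(q+1)$. Then there exist a solid $S\subseteq H$ such that $S\cap\mathcal Q$ is a hyperbolic quadric $\mathsf{Q}^+(3,q)$ (so that $S^\perp$ is a line containing no point of $\mathcal Q$ and containing $H^\perp$), a line $\ell_1\subseteq S$ containing no point of $\mathcal Q$, and two points $p_1,p_2$ of the line $S^\perp$, both different from $H^\perp$, with $p_2\in p_1^\perp$, such that, with $\ell_2:=\ell_1^\perp\cap S$, the set $Z$ is the union of the four conics $\mathcal Q\cap\langle p_1,\ell_1\rangle$, $\mathcal Q\cap\langle p_2,\ell_2\rangle$, $\mathcal Q\cap\langle p_1^\sigma,\ell_1\rangle$ and $\mathcal Q\cap\langle p_2^\sigma,\ell_2\rangle$.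
   Context: Let $q>2$ be a prime power. Let $\mathcal Q$ be an elliptic quadric $\mathsf{Q}^-(5,q)$ in $\mathrm{PG}(5,q)$ with associated polarity $\perp$, $H$ a hyperplane with $H\cap\mathcal Q$ a parabolic quadric $\mathsf Q(4,q)$, $X:=\mathcal Q\setminus H$. Points $u,v\in\mathcal Q$ are collinear ($u\sim v$) if $u\ne v$ and $v\in u^\perp$. $\sigma$ is the central collineation of $\mathrm{PG}(5,q)$ with axis $H$ and centre $H^\perp$ which maps each $p\in X$ to the other point $p^\sigma$ of $\mathcal Q$ on the line joining $H^\perp$ and $p$ (an involution). Relations on $X$: $R_0=\{(u,v):u=v\}$, $R_1=\{(u,v): v\not\sim u\sim v^\sigma\}$, $R_2=\{(u,v): v\not\sim u\not\sim v^\sigma\}$, $R_3=\{(u,v): v\sim u\not\sim v^\sigma\}$, $R_4=\{(u,v):u=v^\sigma\}$, adjacency matrices $A_0,\dots,A_4$. They form a symmetric association scheme; $\mathbb R^X$ is the orthogonal sum of common eigenspaces $V_0,\dots,V_4$ ($V_0=\langle j\rangle$), numbered so that $A_kv=P_{ik}v$ for $v\in V_i$, with $P=\begin{pmatrix}1&(q-1)(q^2+1)&(q-2)q(q^2+1)&(q-1)(q^2+1)&1\\1&q^2+1&0&-(q^2+1)&-1\\1&q-1&-2q&q-1&1\\1&-(q-1)&0&q-1&-1\\1&-(q-1)^2&2(q-2)q&-(q-1)^2&1\end{pmatrix}$. $\chi_Z$ is the characteristic vector of $Z$.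
   Formalization: R_2 is taken to exclude the pairs with u=v or u=v^σ (as printed it contains them, contradicting P), and p_1, p_2 are not required to be distinct: for q odd they are automatically, for q even p_2 in p_1^⊥ on the line S^⊥ forces p_1=p_2. *)

theory Defs
  imports "HOL-Analysis.Analysis"
begin

text \<open>
  Projective subspaces of the projective space of a vector space over a finite field are
  represented by the linear subspaces themselves; incidence is inclusion. A subspace of
  projective dimension \<open>d\<close> has vector space dimension \<open>d + 1\<close>.
\<close>

definition proj_subspace :: "nat \<Rightarrow> ('a::field ^ 'n) set \<Rightarrow> bool" where
  "proj_subspace d U \<longleftrightarrow> vec.subspace U \<and> vec.dim U = d + 1"

abbreviation "proj_point \<equiv> proj_subspace 0"
abbreviation "proj_line \<equiv> proj_subspace 1"
abbreviation "proj_plane \<equiv> proj_subspace 2"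
abbreviation "proj_solid \<equiv> proj_subspace 3"

definition proj_hyperplane :: "('a::field ^ 'n) set \<Rightarrow> bool" where
  "proj_hyperplane U \<longleftrightarrow> vec.subspace U \<and> vec.dim U + 1 = CARD('n)"

definition proj_join :: "('a::field ^ 'n) set \<Rightarrow> ('a ^ 'n) set \<Rightarrow> ('a ^ 'n) set" where
  "proj_join U W = vec.span (U \<union> W)"

subsection \<open>Quadrics\<close>

definition polar_form :: "('a::field ^ 'n \<Rightarrow> 'a) \<Rightarrow> 'a ^ 'n \<Rightarrow> 'a ^ 'n \<Rightarrow> 'a" where
  "polar_form f x y = f (x + y) - f x - f y"

text \<open>Valid in every characteristic; the polar form is symmetric, so linearity in the first
  argument gives bilinearity.\<close>

definition quadratic_form :: "('a::field ^ 'n \<Rightarrow> 'a) \<Rightarrow> bool" where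
  "quadratic_form f \<longleftrightarrow>
     (\<forall>c x. f (c *s x) = c\<^sup>2 * f x) \<and>
     (\<forall>x y z. polar_form f (x + y) z = polar_form f x z + polar_form f y z) \<and>
     (\<forall>c x z. polar_form f (c *s x) z = c * polar_form f x z)"

definition totally_singular :: "('a::field ^ 'n \<Rightarrow> 'a) \<Rightarrow> ('a ^ 'n) set \<Rightarrow> bool" where
  "totally_singular f U \<longleftrightarrow> vec.subspace U \<and> (\<forall>x\<in>U. f x = 0)"

definition quadric :: "('a::field ^ 'n \<Rightarrow> 'a) \<Rightarrow> ('a ^ 'n) set set" where
  "quadric f = {p. proj_point p \<and> totally_singular f p}"

text \<open>\<open>quadric_in f U\<close> is the intersection of the quadric with the subspace \<open>U\<close>.\<close>

definition quadric_in :: "('a::field ^ 'n \<Rightarrow> 'a) \<Rightarrow> ('a ^ 'n) set \<Rightarrow> ('a ^ 'n) set set" where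
  "quadric_in f U = {p \<in> quadric f. p \<subseteq> U}"

text \<open>The polarity associated with the quadric (a symplectic one in characteristic 2).\<close>

definition perp :: "('a::field ^ 'n \<Rightarrow> 'a) \<Rightarrow> ('a ^ 'n) set \<Rightarrow> ('a ^ 'n) set" where
  "perp f U = {y. \<forall>x\<in>U. polar_form f x y = 0}"

text \<open>Nonsingularity of the quadric induced on \<open>W\<close>. In characteristic 2 the polar form may be
  degenerate on \<open>W\<close> although the quadric is nonsingular (the radical is then the nucleus).\<close>

definition nonsingular_on :: "('a::field ^ 'n \<Rightarrow> 'a) \<Rightarrow> ('a ^ 'n) set \<Rightarrow> bool" where
  "nonsingular_on f W \<longleftrightarrow> (\<forall>x\<in>W. f x = 0 \<and> (\<forall>y\<in>W. polar_form f x y = 0) \<longrightarrow> x = 0)"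

definition witt_index :: "('a::field ^ 'n \<Rightarrow> 'a) \<Rightarrow> ('a ^ 'n) set \<Rightarrow> nat" where
  "witt_index f W = Max {vec.dim U | U. totally_singular f U \<and> U \<subseteq> W}"

text \<open>The quadric induced on \<open>W\<close> is of type \<open>Q\<^sup>-(2n+1,q)\<close>, \<open>Q(2n,q)\<close> and
  \<open>Q\<^sup>+(2n-1,q)\<close>, respectively, where \<open>n\<close> is its Witt index.\<close>

definition elliptic_on :: "('a::field ^ 'n \<Rightarrow> 'a) \<Rightarrow> ('a ^ 'n) set \<Rightarrow> bool" where
  "elliptic_on f W \<longleftrightarrow>
     vec.subspace W \<and> nonsingular_on f W \<and> vec.dim W = 2 * witt_index f W + 2"

definition parabolic_on :: "('a::field ^ 'n \<Rightarrow> 'a) \<Rightarrow> ('a ^ 'n) set \<Rightarrow> bool" where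
  "parabolic_on f W \<longleftrightarrow>
     vec.subspace W \<and> nonsingular_on f W \<and> vec.dim W = 2 * witt_index f W + 1"

definition hyperbolic_on :: "('a::field ^ 'n \<Rightarrow> 'a) \<Rightarrow> ('a ^ 'n) set \<Rightarrow> bool" where
  "hyperbolic_on f W \<longleftrightarrow>
     vec.subspace W \<and> nonsingular_on f W \<and> vec.dim W = 2 * witt_index f W"

definition conic_plane :: "('a::field ^ 'n \<Rightarrow> 'a) \<Rightarrow> ('a ^ 'n) set \<Rightarrow> bool" where
  "conic_plane f U \<longleftrightarrow> proj_plane U \<and> parabolic_on f U"

subsection \<open>Central collineations\<close>

text \<open>Collineations are given by their action on points; values of \<open>g\<close> on sets that are not
  points are irrelevant. Below, \<open>A\<close> is the axis and \<open>C\<close> the centre.\<close>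

definition collineation :: "(('a::field ^ 'n) set \<Rightarrow> ('a ^ 'n) set) \<Rightarrow> bool" where
  "collineation g \<longleftrightarrow>
     bij_betw g {p. proj_point p} {p. proj_point p} \<and>
     (\<forall>l. proj_line l \<longrightarrow> (\<exists>m. proj_line m \<and>
        g ` {p. proj_point p \<and> p \<subseteq> l} = {p. proj_point p \<and> p \<subseteq> m}))"

definition central_collineation ::
    "(('a::field ^ 'n) set \<Rightarrow> ('a ^ 'n) set) \<Rightarrow> ('a ^ 'n) set \<Rightarrow> ('a ^ 'n) set \<Rightarrow> bool" where
  "central_collineation g A C \<longleftrightarrow>
     collineation g \<and> proj_hyperplane A \<and> proj_point C \<and>
     (\<forall>p. proj_point p \<and> p \<subseteq> A \<longrightarrow> g p = p) \<and>
     (\<forall>p. proj_point p \<longrightarrow> g p \<subseteq> proj_join C p)"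

subsection \<open>The association scheme\<close>

definition quadric_minus :: "('a::field ^ 'n \<Rightarrow> 'a) \<Rightarrow> ('a ^ 'n) set \<Rightarrow> ('a ^ 'n) set set" where
  "quadric_minus f H = quadric f - quadric_in f H"

text \<open>The condition on the points of \<open>quadric_minus f H\<close> determines the central collineation
  with axis \<open>H\<close> and centre \<open>perp f H\<close> uniquely on the points of the whole space.\<close>

definition quadric_involution ::
    "('a::field ^ 'n \<Rightarrow> 'a) \<Rightarrow> ('a ^ 'n) set \<Rightarrow> (('a ^ 'n) set \<Rightarrow> ('a ^ 'n) set) \<Rightarrow> bool" where
  "quadric_involution f H \<sigma> \<longleftrightarrow>
     central_collineation \<sigma> H (perp f H) \<and>
     (\<forall>p \<in> quadric_minus f H.
        \<sigma> p \<noteq> p \<and> quadric_in f (proj_join (perp f H) p) = {p, \<sigma> p})"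

definition collinear_pts ::
    "('a::field ^ 'n \<Rightarrow> 'a) \<Rightarrow> ('a ^ 'n) set \<Rightarrow> ('a ^ 'n) set \<Rightarrow> bool" where
  "collinear_pts f u v \<longleftrightarrow> u \<noteq> v \<and> v \<subseteq> perp f u"

text \<open>Since a point is not collinear with itself, and not with its image under \<open>\<sigma>\<close>, relation 2
  has to exclude the pairs of relations 0 and 4 explicitly for the five relations to partition
  \<open>X \<times> X\<close>.\<close>

definition scheme_rel ::
    "('a::field ^ 'n \<Rightarrow> 'a) \<Rightarrow> ('a ^ 'n) set \<Rightarrow> (('a ^ 'n) set \<Rightarrow> ('a ^ 'n) set) \<Rightarrow>
     nat \<Rightarrow> (('a ^ 'n) set \<times> ('a ^ 'n) set) set" where
  "scheme_rel f H \<sigma> k = {(u, v) \<in> quadric_minus f H \<times> quadric_minus f H.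
     [u = v,
      \<not> collinear_pts f u v \<and> collinear_pts f u (\<sigma> v),
      \<not> collinear_pts f u v \<and> \<not> collinear_pts f u (\<sigma> v) \<and> u \<noteq> v \<and> u \<noteq> \<sigma> v,
      collinear_pts f u v \<and> \<not> collinear_pts f u (\<sigma> v),
      u = \<sigma> v] ! k}"

definition scheme_adj ::
    "('a::field ^ 'n \<Rightarrow> 'a) \<Rightarrow> ('a ^ 'n) set \<Rightarrow> (('a ^ 'n) set \<Rightarrow> ('a ^ 'n) set) \<Rightarrow>
     nat \<Rightarrow> ('a ^ 'n) set \<Rightarrow> ('a ^ 'n) set \<Rightarrow> real" where
  "scheme_adj f H \<sigma> k u v = of_bool ((u, v) \<in> scheme_rel f H \<sigma> k)"

definition scheme_P :: "real \<Rightarrow> nat \<Rightarrow> nat \<Rightarrow> real" where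
  "scheme_P q i k =
    [[1, (q - 1) * (q\<^sup>2 + 1), (q - 2) * q * (q\<^sup>2 + 1), (q - 1) * (q\<^sup>2 + 1), 1],
     [1, q\<^sup>2 + 1,             0,                      - (q\<^sup>2 + 1),         - 1],
     [1, q - 1,              - 2 * q,                q - 1,               1],
     [1, - (q - 1),          0,                      q - 1,               - 1],
     [1, - (q - 1)\<^sup>2,         2 * (q - 2) * q,        - (q - 1)\<^sup>2,         1]] ! i ! k"

text \<open>The common eigenspace \<open>V\<^sub>i\<close>. Elements of \<open>\<real>\<^sup>X\<close>, for \<open>X = quadric_minus f H\<close>, are
  represented by functions vanishing outside \<open>X\<close>.\<close>

definition scheme_eigenspace ::
    "('a::{field,finite} ^ 'n \<Rightarrow> 'a) \<Rightarrow> ('a ^ 'n) set \<Rightarrow> (('a ^ 'n) set \<Rightarrow> ('a ^ 'n) set) \<Rightarrow>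
     nat \<Rightarrow> (('a ^ 'n) set \<Rightarrow> real) set" where
  "scheme_eigenspace f H \<sigma> i = {w.
     (\<forall>u. u \<notin> quadric_minus f H \<longrightarrow> w u = 0) \<and>
     (\<forall>k\<le>4. \<forall>u \<in> quadric_minus f H.
        (\<Sum>v \<in> quadric_minus f H. scheme_adj f H \<sigma> k u v * w v)
          = scheme_P (real CARD('a)) i k * w u)}"

definition fun_sum :: "('b \<Rightarrow> real) set \<Rightarrow> ('b \<Rightarrow> real) set \<Rightarrow> ('b \<Rightarrow> real) set" where
  "fun_sum V W = {\<lambda>u. v u + w u | v w. v \<in> V \<and> w \<in> W}"

end

theory Submission
  imports Defs
begin

text \<open>
  Let \<open>Q\<close> be the quadric. The three matrix equations for \<open>A\<^sub>0 + \<dots> + A\<^sub>4\<close>, \<open>A\<^sub>3\<close> and \<open>A\<^sub>4\<close> say that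
  \<open>Z\<close> is invariant under \<open>\<sigma>\<close> and that a point of \<open>X\<close> is collinear with exactly 4 points of \<open>Z\<close> if it lies
  outside \<open>Z\<close>, and with \<open>q + 3\<close> points of \<open>Z\<close> if it lies in \<open>Z\<close>. Summing over the points of a line of \<open>Q\<close>
  shows that points of \<open>Q \<inter> H\<close> are also collinear with 4 points of \<open>Z\<close> (or none), so a line contains at most
  2 points of \<open>Z\<close> and the neighbours in \<open>Z\<close> of a point of \<open>Z\<close> are pairwise non-collinear.

  Fix \<open>u \<in> Z\<close> and count the triples \<open>(x, v, w)\<close> where \<open>x \<in> Z\<close> is collinear with \<open>u, v, w \<in> Z\<close>: since only
  \<open>3q\<close> points of \<open>Z\<close> are not collinear with \<open>u\<close>, for large \<open>q\<close> some three pairwise non-collinear points of \<open>Z\<close>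
  have at least 5 common neighbours in \<open>Z\<close>. Any point of \<open>Q\<close> collinear with at least 5 points
  of \<open>Z\<close> belongs to \<open>Z\<close>; hence \<open>Z\<close> contains the conic \<open>C\<close> through these three points and the conic \<open>C'\<close> in the
  polar plane. Comparing cardinalities, \<open>Z = C \<union> C' \<union> C\<^sup>\<sigma> \<union> C'\<^sup>\<sigma>\<close>, and \<open>S\<close> is spanned by the lines \<open>l1\<close>, \<open>l2\<close>
  in which the planes of the two conics meet \<open>H\<close>.

  It remains to determine the type of \<open>S\<close>. Counting neighbours again, some point of \<open>C\<close> is collinear with a point
  of \<open>C\<^sup>\<sigma>\<close>. The line joining them is the graph of an anti-isometry between \<open>l1\<close> and \<open>S\<^sup>\<perp>\<close>, so \<open>S\<^sup>\<perp>\<close> has no singular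
  point. The same holds for \<open>l2\<close>, and composing with a similitude of \<open>S\<^sup>\<perp>\<close> with factor \<open>-1\<close> gives an anti-isometry
  between \<open>l1\<close> and \<open>l2\<close>, whose graph is a totally singular line of \<open>S\<close>.
\<close>

section \<open>Quadratic forms\<close>

lemma proj_point_iff: "proj_point p \<longleftrightarrow> (\<exists>x. x \<noteq> 0 \<and> p = vec.span {x})"
proof
  assume p: "proj_point p"
  then have s: "vec.subspace p" and d: "vec.dim p = 1" by (auto simp: proj_subspace_def)
  from d have "\<not> p \<subseteq> {0}" using vec.dim_eq_0[of p] by simp
  then obtain x where x: "x \<in> p" "x \<noteq> 0" by auto
  have "vec.span {x} = p"
    by (rule vec.subspace_dim_equal) (use x s d in \<open>auto simp: vec.span_minimal\<close>)
  then show "\<exists>x. x \<noteq> 0 \<and> p = vec.span {x}" using x by auto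
qed (auto simp: proj_subspace_def)

lemma span_subset_iff: "vec.subspace U \<Longrightarrow> vec.span {x} \<subseteq> U \<longleftrightarrow> x \<in> U"
  by (meson empty_subsetI insert_subset subset_trans vec.span_minimal vec.span_superset)

lemma span_sing_eq_iff:
  assumes "x \<noteq> 0"
  shows "vec.span {x} = vec.span {y} \<longleftrightarrow> y \<noteq> 0 \<and> (\<exists>k. y = k *s x)"
proof
  assume eq: "vec.span {x} = vec.span {y}"
  then have "y \<in> vec.span {x}" by (simp add: vec.span_base)
  moreover have "y \<noteq> 0" using eq assms vec.span_base[of x "{x}"] by auto
  ultimately show "y \<noteq> 0 \<and> (\<exists>k. y = k *s x)" by (auto simp: vec.span_singleton)
next
  assume "y \<noteq> 0 \<and> (\<exists>k. y = k *s x)"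
  then obtain k where k: "y = k *s x" "k \<noteq> 0" by auto
  show "vec.span {x} = vec.span {y}"
  proof (rule antisym)
    have "x = (1/k) *s y" using k by (simp add: vector_smult_assoc)
    then show "vec.span {x} \<subseteq> vec.span {y}"
      by (metis span_subset_iff vec.subspace_span vec.span_scale vec.span_base singletonI)
    show "vec.span {y} \<subseteq> vec.span {x}"
      using k by (metis span_subset_iff vec.subspace_span vec.span_scale vec.span_base singletonI)
  qed
qed

lemma in_span2: "x \<in> vec.span {a, b} \<longleftrightarrow> (\<exists>s t. x = s *s a + t *s b)"
  by (auto simp: vec.span_insert vec.span_singleton algebra_simps)

lemma in_span3: "x \<in> vec.span {a, b, c} \<longleftrightarrow> (\<exists>r s t. x = r *s a + s *s b + t *s c)"
proof -
  have "x \<in> vec.span {a, b, c} \<longleftrightarrow> (\<exists>r. x - r *s a \<in> vec.span {b, c})"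
    by (rule vec.span_breakdown_eq)
  also have "\<dots> \<longleftrightarrow> (\<exists>r s t. x - r *s a = s *s b + t *s c)" by (simp add: in_span2)
  also have "\<dots> \<longleftrightarrow> (\<exists>r s t. x = r *s a + s *s b + t *s c)" by (simp add: algebra_simps)
  finally show ?thesis .
qed

lemma dim_span2:
  assumes "x \<noteq> 0" "\<And>k. y \<noteq> k *s x"
  shows "vec.dim (vec.span {x, y}) = 2"
proof -
  have "y \<notin> vec.span {x}" using assms(2) by (auto simp: vec.span_singleton)
  then have "vec.dim {y, x} = 2" using assms(1) by (simp add: vec.dim_insert)
  then show ?thesis by (simp add: insert_commute)
qed

section \<open>Calculus of the polar form, perpendicular subspaces and singular points\<close>

locale quad_form =
  fixes f :: "'a::field ^ 'n \<Rightarrow> 'a"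
  assumes quadratic_form: "quadratic_form f"
begin

abbreviation "b \<equiv> polar_form f"

lemma f_scale: "f (c *s x) = c\<^sup>2 * f x"
  using quadratic_form by (auto simp: quadratic_form_def)

lemma b_add_left: "b (x + y) z = b x z + b y z"
  using quadratic_form by (auto simp: quadratic_form_def)

lemma b_scale_left: "b (c *s x) z = c * b x z"
  using quadratic_form by (auto simp: quadratic_form_def)

lemma b_commute: "b x y = b y x"
  by (simp add: polar_form_def add.commute)

lemma b_add_right: "b z (x + y) = b z x + b z y"
  by (metis b_add_left b_commute)

lemma b_scale_right: "b z (c *s x) = c * b z x"
  by (metis b_scale_left b_commute)

lemma b_0_left [simp]: "b 0 z = 0"
  using b_scale_left[of 0 0 z] by simp

lemma b_0_right [simp]: "b z 0 = 0"
  by (metis b_0_left b_commute)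

lemma b_minus_left: "b (- x) z = - b x z"
  using b_add_left[of x "-x" z] by (simp add: eq_neg_iff_add_eq_0 add.commute)

lemma b_minus_right: "b z (- x) = - b z x"
  by (metis b_minus_left b_commute)

lemma b_diff_left: "b (x - y) z = b x z - b y z"
  using b_add_left[of x "-y" z] by (simp add: b_minus_left)

lemma b_diff_right: "b z (x - y) = b z x - b z y"
  by (metis b_diff_left b_commute)

lemmas b_simps = b_add_left b_add_right b_scale_left b_scale_right b_minus_left b_minus_right
  b_diff_left b_diff_right

lemma f_add: "f (x + y) = f x + f y + b x y"
  by (simp add: polar_form_def)

lemma f_0 [simp]: "f 0 = 0"
  using f_scale[of 0 0] by simp

lemma b_self: "b x x = 2 * f x"
proof -
  have "x + x = 2 *s x" by (simp add: vec_eq_iff)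
  then have "f (x + x) = 4 * f x" by (simp add: f_scale)
  then show ?thesis by (simp add: polar_form_def)
qed

lemma f_diff: "f (x - y) = f x + f y - b x y"
  using f_add[of x "-y"] f_scale[of "-1" y] by (simp add: b_minus_right)

lemma f_minus [simp]: "f (- x) = f x"
  using f_diff[of 0 x] by simp

lemmas f_simps = f_add f_diff f_scale

lemma subspace_perp: "vec.subspace (perp f U)"
  by (auto simp: perp_def vec.subspace_def b_simps)

lemma in_perp_span_iff: "y \<in> perp f (vec.span B) \<longleftrightarrow> (\<forall>x\<in>B. b x y = 0)"
proof
  assume *: "\<forall>x\<in>B. b x y = 0"
  have "B \<subseteq> perp f {y}" using * by (auto simp: perp_def b_commute)
  then have "vec.span B \<subseteq> perp f {y}" by (rule vec.span_minimal) (rule subspace_perp)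
  then show "y \<in> perp f (vec.span B)" by (auto simp: perp_def b_commute)
qed (auto simp: perp_def vec.span_base)

lemma perp_antimono: "U \<subseteq> W \<Longrightarrow> perp f W \<subseteq> perp f U"
  by (auto simp: perp_def)

lemma subset_perp_perp: "U \<subseteq> perp f (perp f U)"
  by (auto simp: perp_def b_commute)

lemma span_subset_perp_span: "vec.span {y} \<subseteq> perp f (vec.span {x}) \<longleftrightarrow> b x y = 0"
  by (simp add: span_subset_iff subspace_perp in_perp_span_iff)

lemma in_quadric_iff: "p \<in> quadric f \<longleftrightarrow> (\<exists>x. x \<noteq> 0 \<and> f x = 0 \<and> p = vec.span {x})"
proof -
  have "totally_singular f (vec.span {x}) \<longleftrightarrow> f x = 0" for x
  proof
    assume "f x = 0"
    then have "\<forall>y\<in>vec.span {x}. f y = 0" by (auto simp: vec.span_singleton f_scale)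
    then show "totally_singular f (vec.span {x})" by (simp add: totally_singular_def)
  qed (auto simp: totally_singular_def vec.span_base)
  then show ?thesis by (auto simp: quadric_def proj_point_iff)
qed

lemma in_quadric_in_iff:
  "vec.subspace U \<Longrightarrow> p \<in> quadric_in f U \<longleftrightarrow> (\<exists>x\<in>U. x \<noteq> 0 \<and> f x = 0 \<and> p = vec.span {x})"
  using span_subset_iff[of U] by (auto simp: quadric_in_def in_quadric_iff)

text \<open>Each vector of a basis of \<open>U\<close> imposes one linear condition on
  \<open>W\<close>, so the dimension drops by at most one for each of them.\<close>

lemma dim_Int_perp_ge:
  assumes "vec.subspace W"
  shows "vec.dim W \<le> vec.dim (W \<inter> perp f U) + vec.dim U"
proof -
  have *: "vec.dim W \<le> vec.dim (W \<inter> perp f (vec.span B)) + card B" if "finite B" for B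
    using that
  proof (induction B)
    case empty
    have "perp f (vec.span {}) = UNIV" by (auto simp: perp_def)
    then show ?case by simp
  next
    case (insert x B)
    let ?V = "W \<inter> perp f (vec.span B)" and ?V' = "W \<inter> perp f (vec.span (insert x B))"
    have V: "vec.subspace ?V" by (simp add: assms subspace_perp vec.subspace_inter)
    have V'_iff: "y \<in> ?V' \<longleftrightarrow> y \<in> ?V \<and> b x y = 0" for y by (auto simp: in_perp_span_iff)
    have "vec.dim ?V \<le> vec.dim ?V' + 1"
    proof (cases "?V \<subseteq> ?V'")
      case True
      then show ?thesis using vec.dim_subset[OF True] by simp
    next
      case False
      then obtain w where w: "w \<in> ?V" "b x w \<noteq> 0" using V'_iff by auto
      \<comment> \<open>As \<open>b x w\<close> is nonzero, subtracting a multiple of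
        \<open>w\<close> moves any \<open>y\<close> into the kernel of the functional
        \<open>b x\<close>.\<close>
      have "?V \<subseteq> vec.span (insert w ?V')"
      proof
        fix y assume y: "y \<in> ?V"
        let ?k = "b x y / b x w"
        have "y - ?k *s w \<in> ?V" using V w y by (meson vec.subspace_diff vec.subspace_scale)
        then have "y - ?k *s w \<in> ?V'" using w(2) by (subst V'_iff) (simp add: b_simps)
        then show "y \<in> vec.span (insert w ?V')"
          by (subst vec.span_breakdown_eq) (blast intro: vec.span_base)
      qed
      then have "vec.dim ?V \<le> vec.dim (insert w ?V')" by (rule vec.dim_mono)
      then show ?thesis by (simp add: vec.dim_insert split: if_splits)
    qed
    then show ?case using insert by simp
  qed
  obtain B where B: "B \<subseteq> U" "vec.independent B" "U \<subseteq> vec.span B" "card B = vec.dim U"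
    using vec.basis_exists by blast
  have "perp f (vec.span B) \<subseteq> perp f U" using B(3) by (rule perp_antimono)
  then have "vec.dim (W \<inter> perp f (vec.span B)) \<le> vec.dim (W \<inter> perp f U)"
    by (intro vec.dim_subset) auto
  then show ?thesis using *[OF vec.finiteI_independent[OF B(2)]] B(4) by linarith
qed

section \<open>Triads: three points of a nondegenerate conic, given by vectors\<close>

definition triad :: "'a ^ 'n \<Rightarrow> 'a ^ 'n \<Rightarrow> 'a ^ 'n \<Rightarrow> bool" where
  "triad u v w \<longleftrightarrow> f u = 0 \<and> f v = 0 \<and> f w = 0 \<and> b u v \<noteq> 0 \<and> b u w \<noteq> 0 \<and> b v w \<noteq> 0"

lemma triadD:
  assumes "triad u v w"
  shows "f u = 0" "f v = 0" "f w = 0" "b u v \<noteq> 0" "b u w \<noteq> 0" "b v w \<noteq> 0"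
    "b v u = b u v" "b w u = b u w" "b w v = b v w" "b u u = 0" "b v v = 0" "b w w = 0"
  using assms by (auto simp: triad_def b_commute b_self)

lemma f_comb3:
  assumes "triad u v w"
  shows "f (r *s u + s *s v + t *s w) = r * s * b u v + r * t * b u w + s * t * b v w"
  using triadD[OF assms] by (simp add: f_simps b_simps algebra_simps)

text \<open>The Gram determinant of a triad is twice a product of nonzero values, so it vanishes in
  characteristic 2. Therefore the linear relations obtained by pairing with \<open>u\<close> and
  \<open>v\<close> are combined with a quadratic one, namely that \<open>r *s u + s *s v\<close> is
  singular.\<close>

lemma triad_independent:
  assumes T: "triad u v w" and 0: "r *s u + s *s v + t *s w = 0"
  shows "r = 0 \<and> s = 0 \<and> t = 0"
proof -
  note T' = triadD[OF T]
  have 1: "s * b u v + t * b u w = 0"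
    using arg_cong[OF 0, of "b u"] T' by (simp add: b_simps)
  have 2: "r * b u v + t * b v w = 0"
    using arg_cong[OF 0, of "b v"] T' by (simp add: b_simps)
  have "r *s u + s *s v = - t *s w" using 0 by (simp add: add_eq_0_iff2)
  then have "f (r *s u + s *s v) = 0" using T' by (simp add: f_scale)
  then have "r = 0 \<or> s = 0" using T' by (auto simp: f_simps b_simps)
  then show ?thesis using 1 2 T' by auto
qed

lemma triad_dim:
  assumes T: "triad u v w"
  shows "vec.dim (vec.span {u, v, w}) = 3"
proof -
  have "u \<notin> vec.span {v, w}"
  proof
    assume "u \<in> vec.span {v, w}"
    then obtain s t where "u = s *s v + t *s w" by (auto simp: in_span2)
    then have "(-1) *s u + s *s v + t *s w = 0" by (simp add: algebra_simps)
    then show False using triad_independent[OF T] by fastforce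
  qed
  moreover have "vec.dim (vec.span {v, w}) = 2"
    by (rule dim_span2) (use triadD[OF T] in \<open>auto simp: b_simps\<close>)
  ultimately show ?thesis by (simp add: vec.dim_insert)
qed

text \<open>In characteristic 2 the plane has a nonzero radical, the nucleus of the conic; the
  condition \<open>f x = 0\<close> is what excludes it.\<close>

lemma triad_nonsingular:
  assumes T: "triad u v w" and x: "x \<in> vec.span {u, v, w}" "f x = 0"
    and perp: "b u x = 0" "b v x = 0" "b w x = 0"
  shows "x = 0"
proof -
  note T' = triadD[OF T]
  obtain r s t where rst: "x = r *s u + s *s v + t *s w" using x by (auto simp: in_span3)
  have 1: "s * b u v + t * b u w = 0" "r * b u v + t * b v w = 0" "r * b u w + s * b v w = 0"
    using perp T' by (simp_all add: rst b_simps)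
  \<comment> \<open>This is \<open>f x = 0\<close> regrouped so that the bracket vanishes by the
    second relation, leaving \<open>r * t = 0\<close>.\<close>
  have "s * (r * b u v + t * b v w) + r * t * b u w = 0"
    using x(2) f_comb3[OF T, of r s t] by (simp add: rst algebra_simps)
  then have "r = 0 \<or> t = 0" using 1 T' by simp
  then show ?thesis using 1 T' by (auto simp: rst)
qed

text \<open>The tangent line of the conic at the point of \<open>u\<close> contains no further point
  of the conic.\<close>

lemma triad_tangent:
  assumes T: "triad u v w" and x: "x \<in> vec.span {u, v, w}" "f x = 0" "b u x = 0"
  shows "\<exists>k. x = k *s u"
proof -
  note T' = triadD[OF T]
  obtain r s t where rst: "x = r *s u + s *s v + t *s w" using x by (auto simp: in_span3)
  have 1: "s * b u v + t * b u w = 0" using x(3) T' by (simp add: rst b_simps)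
  have "r * (s * b u v + t * b u w) + s * t * b v w = 0"
    using x(2) f_comb3[OF T, of r s t] by (simp add: rst algebra_simps)
  then have "s = 0 \<or> t = 0" using 1 T' by simp
  then show ?thesis using 1 T' rst by auto
qed

lemma triad_rotate: "triad u v w \<Longrightarrow> triad v w u"
  by (simp add: triad_def b_commute)

lemma witt_index_eqI:
  assumes "totally_singular f U" "U \<subseteq> W" "vec.dim U = n"
    and "\<And>U. totally_singular f U \<Longrightarrow> U \<subseteq> W \<Longrightarrow> vec.dim U \<le> n"
  shows "witt_index f W = n"
  unfolding witt_index_def
proof (rule Max_eqI)
  show "finite {vec.dim U |U. totally_singular f U \<and> U \<subseteq> W}"
    by (rule finite_subset[of _ "{..n}"]) (use assms(4) in auto)
qed (use assms in auto)

lemma totally_singular_0: "totally_singular f U \<Longrightarrow> x \<in> U \<Longrightarrow> y \<in> U \<Longrightarrow> b x y = 0"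
  by (metis add_0 cancel_comm_monoid_add_class.diff_cancel diff_0_right polar_form_def
      totally_singular_def vec.subspace_add)

lemma totally_singular_span: "f x = 0 \<Longrightarrow> totally_singular f (vec.span {x})"
proof -
  assume "f x = 0"
  then have "\<forall>y\<in>vec.span {x}. f y = 0" by (auto simp: vec.span_singleton f_scale)
  then show ?thesis by (simp add: totally_singular_def)
qed

text \<open>A totally singular subspace of dimension at least 2 has a nonzero vector orthogonal to
  \<open>u\<close>. By \<open>triad_tangent\<close> this is a multiple of \<open>u\<close>, so the
  subspace contains \<open>u\<close> and, by rotating the triad, also \<open>v\<close>; but
  \<open>b u v\<close> is nonzero.\<close>

lemma triad_conic_plane:
  assumes T: "triad u v w"
  shows "conic_plane f (vec.span {u, v, w})"
proof -
  let ?W = "vec.span {u, v, w}"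
  note T' = triadD[OF T]
  have gen: "u \<in> ?W" "v \<in> ?W" "w \<in> ?W" by (auto simp: vec.span_base)
  have "witt_index f ?W = 1"
  proof (rule witt_index_eqI)
    show "totally_singular f (vec.span {u})" using T' by (simp add: totally_singular_span)
    show "vec.span {u} \<subseteq> ?W" using gen by (simp add: span_subset_iff)
    show "vec.dim (vec.span {u}) = 1" using T' by auto
    fix U assume U: "totally_singular f U" "U \<subseteq> ?W"
    have subU: "vec.subspace U" using U by (simp add: totally_singular_def)
    show "vec.dim U \<le> 1"
    proof (rule ccontr)
      assume d: "\<not> vec.dim U \<le> 1"
      have in_U: "x \<in> U" if T: "triad x y z" and W: "U \<subseteq> vec.span {x, y, z}" for x y z
      proof -
        have "vec.dim U \<le> vec.dim (U \<inter> perp f (vec.span {x})) + vec.dim (vec.span {x})"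
          by (rule dim_Int_perp_ge[OF subU])
        moreover have "vec.dim (vec.span {x}) \<le> 1" by simp
        ultimately have "\<not> U \<inter> perp f (vec.span {x}) \<subseteq> {0}"
          using d by (metis add_0 vec.dim_eq_0 order_trans)
        then obtain y where y: "y \<in> U" "y \<in> perp f (vec.span {x})" "y \<noteq> 0" by blast
        then have y: "y \<in> U" "b x y = 0" "y \<noteq> 0" by (auto simp: in_perp_span_iff)
        then obtain k where "y = k *s x"
          using triad_tangent[OF T, of y] W U by (auto simp: totally_singular_def)
        then have "x = (1/k) *s y" using y by (auto simp: vector_smult_assoc)
        then show "x \<in> U" using y subU vec.subspace_scale by metis
      qed
      have "u \<in> U" "v \<in> U"
        using in_U[OF T] in_U[OF triad_rotate[OF T]] U by (auto simp: insert_commute)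
      then show False using totally_singular_0 U T' by blast
    qed
  qed
  moreover have "nonsingular_on f ?W"
    unfolding nonsingular_on_def using triad_nonsingular[OF T] gen by (metis b_commute)
  ultimately show ?thesis
    using triad_dim[OF T]
    by (simp add: conic_plane_def proj_subspace_def parabolic_on_def)
qed

end

section \<open>Lines without singular points over finite fields\<close>

lemma finite_field_char2_square:
  fixes a :: "'a::{field,finite}"
  assumes "(2::'a) = 0"
  shows "\<exists>k. k\<^sup>2 = a"
proof -
  have "inj (\<lambda>k::'a. k\<^sup>2)"
  proof (rule injI)
    fix k l :: 'a assume "k\<^sup>2 = l\<^sup>2"
    then have "(k + l)\<^sup>2 = 2 * l\<^sup>2 + 2 * k * l" by (simp add: power2_sum)
    then have "k + l = 0" using assms by simp
    moreover have "l + l = 0" using assms by (metis mult_2 mult_zero_left)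
    ultimately show "k = l" by (metis add_right_cancel)
  qed
  then have "surj (\<lambda>k::'a. k\<^sup>2)" by (simp add: finite_UNIV_inj_surj)
  then show ?thesis by (metis surjD)
qed

text \<open>Squaring is at most two-to-one, and the inequality is strict because 0 has a single
  root.\<close>

lemma finite_field_card_squares:
  assumes "(2::'a::{field,finite}) \<noteq> 0"
  shows "CARD('a) < 2 * card (range (\<lambda>x::'a. x\<^sup>2))"
proof -
  let ?Q = "range (\<lambda>x::'a. x\<^sup>2)"
  have "CARD('a) = card (\<Union>y\<in>?Q. {x. x\<^sup>2 = y})" by (rule arg_cong[of _ _ card]) auto
  also have "\<dots> \<le> (\<Sum>y\<in>?Q. card {x. x\<^sup>2 = y})" by (rule card_UN_le) simp
  also have "\<dots> = card {x::'a. x\<^sup>2 = 0} + (\<Sum>y\<in>?Q - {0}. card {x. x\<^sup>2 = y})"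
    by (rule sum.remove) (auto intro: range_eqI[of _ _ 0])
  also have "\<dots> \<le> 1 + (\<Sum>y\<in>?Q - {0}. 2)"
  proof (rule add_mono)
    have "{x::'a. x\<^sup>2 = 0} = {0}" by auto
    then show "card {x::'a. x\<^sup>2 = 0} \<le> 1" by simp
    show "(\<Sum>y\<in>?Q - {0}. card {x. x\<^sup>2 = y}) \<le> (\<Sum>y\<in>?Q - {0}. 2)"
    proof (rule sum_mono)
      fix y assume "y \<in> ?Q - {0}"
      then obtain z where "y = z\<^sup>2" by auto
      then have "{x. x\<^sup>2 = y} = {z, -z}" by (auto simp: power2_eq_iff)
      then show "card {x. x\<^sup>2 = y} \<le> 2" by (simp add: card_insert_if)
    qed
  qed
  also have "\<dots> = 2 * card ?Q - 1"
  proof -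
    have "0 \<in> ?Q" by (rule range_eqI[of _ _ 0]) simp
    then have "card (?Q - {0}) = card ?Q - 1" "card ?Q > 0" by (auto simp: card_gt_0_iff)
    then show ?thesis by simp
  qed
  finally show ?thesis
    using card_gt_0_iff[of ?Q] by auto
qed

text \<open>The values of \<alpha> x^2 and those of \<delta> - \<gamma> y^2 each fill more than half
  of the field, so the two sets meet.\<close>

lemma finite_field_binary_form_universal:
  fixes \<alpha> \<gamma> \<delta> :: "'a::{field,finite}"
  assumes "(2::'a) \<noteq> 0" "\<alpha> \<noteq> 0" "\<gamma> \<noteq> 0"
  shows "\<exists>x y. \<alpha> * x\<^sup>2 + \<gamma> * y\<^sup>2 = \<delta>"
proof -
  let ?Q = "range (\<lambda>x::'a. x\<^sup>2)"
  let ?A = "(\<lambda>z. \<alpha> * z) ` ?Q" and ?B = "(\<lambda>z. \<delta> - \<gamma> * z) ` ?Q"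
  have "card ?A = card ?Q" "card ?B = card ?Q"
    by (rule card_image, rule inj_onI, use assms in simp)+
  then have "CARD('a) < card ?A + card ?B"
    using finite_field_card_squares[OF assms(1)] by simp
  moreover have "card (?A \<union> ?B) \<le> CARD('a)" by (rule card_mono) auto
  ultimately have "?A \<inter> ?B \<noteq> {}" using card_Un_disjoint[of ?A ?B] by fastforce
  then obtain x y where "\<alpha> * x\<^sup>2 = \<delta> - \<gamma> * y\<^sup>2" by auto
  then have "\<alpha> * x\<^sup>2 + \<gamma> * y\<^sup>2 = \<delta>" by simp
  then show ?thesis by blast
qed

section \<open>The elliptic quadric: polar subspaces, totally singular lines, and sizes of
  conics\<close>

locale elliptic_form = quad_form f for f :: "'a::{field,finite} ^ 6 \<Rightarrow> 'a" +
  assumes nondegenerate: "(\<And>y. b x y = 0) \<Longrightarrow> x = 0"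
    and totally_singular_dim_le: "totally_singular f U \<Longrightarrow> vec.dim U \<le> 2"
begin

text \<open>One inequality is \<open>dim_Int_perp_ge\<close> for the whole space. For the other,
  extend a basis of \<open>U\<close>: the perp of the complementary span meets
  \<open>perp f U\<close> trivially by nondegeneracy, which bounds the dimension of
  \<open>perp f U\<close> by that of the complement.\<close>

lemma dim_perp:
  assumes "vec.subspace U"
  shows "vec.dim (perp f U) + vec.dim U = 6"
proof -
  have U6: "vec.dim (UNIV :: ('a^6) set) = 6" by (simp only: vec_dim_card) simp
  obtain B where B: "B \<subseteq> U" "vec.independent B" "U \<subseteq> vec.span B" "card B = vec.dim U"
    using vec.basis_exists by blast
  obtain B' where B': "B \<subseteq> B'" "vec.independent B'" "UNIV \<subseteq> vec.span B'"
    using vec.maximal_independent_subset_extend[of B UNIV] B(2) by auto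
  have fin: "finite B'" using B'(2) by (rule vec.finiteI_independent)
  have cB': "card B' = 6" using vec.dim_unique[of B' UNIV] B' U6 by auto
  have "perp f U \<inter> perp f (vec.span (B' - B)) \<subseteq> {0}"
  proof
    fix y assume y: "y \<in> perp f U \<inter> perp f (vec.span (B' - B))"
    then have "y \<in> perp f (vec.span B')"
      using B(1) vec.span_base[of _ "B' - B"] unfolding in_perp_span_iff
      by (force simp: perp_def)
    then have "b y x = 0" for x using B'(3) by (auto simp: perp_def b_commute)
    then show "y \<in> {0}" using nondegenerate by auto
  qed
  then have "vec.dim (perp f U \<inter> perp f (vec.span (B' - B))) = 0" by (simp add: vec.dim_eq_0)
  moreover have "vec.dim (vec.span (B' - B)) \<le> 6 - vec.dim U"
  proof -
    have "vec.dim (vec.span (B' - B)) \<le> card (B' - B)" using fin by (simp add: vec.dim_le_card')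
    then show ?thesis using B B'(1) cB' fin by (metis card_Diff_subset finite_subset)
  qed
  ultimately have "vec.dim (perp f U) \<le> 6 - vec.dim U"
    using dim_Int_perp_ge[OF subspace_perp, of U "vec.span (B' - B)"] by linarith
  moreover have "6 \<le> vec.dim (perp f U) + vec.dim U"
    using dim_Int_perp_ge[of UNIV U] U6 by simp
  moreover have "vec.dim U \<le> 6" using vec.dim_subset[of U UNIV] U6 by simp
  ultimately show ?thesis by linarith
qed

lemma perp_perp:
  assumes "vec.subspace U"
  shows "perp f (perp f U) = U"
proof -
  have "U = perp f (perp f U)"
    by (rule vec.subspace_dim_equal[OF assms subspace_perp subset_perp_perp])
      (use dim_perp[OF assms] dim_perp[OF subspace_perp, of U] in linarith)
  then show ?thesis by simp
qed

text \<open>Otherwise the three vectors would span a totally singular plane, and the quadric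
  contains none.\<close>

lemma totally_singular_span3:
  assumes "f x = 0" "f y = 0" "f z = 0" "b x y = 0" "b x z = 0" "b y z = 0"
    and "x \<noteq> 0" "\<And>k. y \<noteq> k *s x"
  shows "z \<in> vec.span {x, y}"
proof (rule ccontr)
  assume z: "z \<notin> vec.span {x, y}"
  have "f v = 0" if "v \<in> vec.span {z, x, y}" for v
    using that assms(1-6) by (auto simp: in_span3 f_simps b_simps b_commute)
  then have "vec.dim (vec.span {z, x, y}) \<le> 2"
    by (intro totally_singular_dim_le) (simp add: totally_singular_def)
  moreover have "vec.dim (vec.span {z, x, y}) = 3"
    using z dim_span2[of x y] assms(7,8) by (simp add: vec.dim_insert)
  ultimately show False by simp
qed

lemma triad_conic_card:
  assumes T: "triad u v w"
  shows "CARD('a) + 1 \<le> card (quadric_in f (vec.span {u, v, w}))"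
proof -
  let ?W = "vec.span {u, v, w}"
  note T' = triadD[OF T]
  define \<kappa> where "\<kappa> t = b u v + t * b u w" for t
  \<comment> \<open>\<open>x t\<close> is the second singular point of the line joining
    \<open>u\<close> to \<open>v + t *s w\<close>; where that line is tangent,
    \<open>\<kappa> t\<close> vanishes and the point is that of \<open>u\<close>. The point of
    \<open>w\<close> belongs to the parameter at infinity and is added separately.\<close>
  define x where "x t = (- t * b v w) *s u + \<kappa> t *s v + (\<kappa> t * t) *s w" for t
  have x_W: "x t \<in> ?W" for t unfolding x_def in_span3 by blast
  have x_f: "f (x t) = 0" for t
    unfolding x_def f_comb3[OF T] \<kappa>_def by (simp add: algebra_simps)
  have x_0: "x t \<noteq> 0" for t
  proof
    assume "x t = 0"
    then have "- t * b v w = 0" "\<kappa> t = 0" using triad_independent[OF T] unfolding x_def by blast+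
    then show False using T' by (simp add: \<kappa>_def)
  qed
  have coord: "r = r' \<and> s = s' \<and> t = t'"
    if "r *s u + s *s v + t *s w = r' *s u + s' *s v + t' *s w" for r s t r' s' t'
  proof -
    have "(r - r') *s u + (s - s') *s v + (t - t') *s w = 0"
      using that by (simp add: vec.scale_left_diff_distrib) (simp add: algebra_simps)
    from triad_independent[OF T this] show ?thesis by simp
  qed
  have inj: "inj (\<lambda>t. vec.span {x t})"
  proof (rule injI)
    fix t t' assume "vec.span {x t} = vec.span {x t'}"
    then obtain k where k: "x t' = k *s x t" using span_sing_eq_iff x_0 by blast
    then have "k \<noteq> 0" using x_0 by auto
    have "(- t' * b v w) *s u + \<kappa> t' *s v + (\<kappa> t' * t') *s w
        = (k * (- t * b v w)) *s u + (k * \<kappa> t) *s v + (k * (\<kappa> t * t)) *s w"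
      using k unfolding x_def by (simp add: vec.scale_right_distrib vector_smult_assoc)
    from coord[OF this] have 1: "\<kappa> t' = k * \<kappa> t" "\<kappa> t' * t' = k * \<kappa> t * t" by auto
    show "t = t'"
    proof (cases "\<kappa> t = 0")
      case True
      then have "\<kappa> t' = \<kappa> t" using 1 by simp
      then show ?thesis using T' by (simp add: \<kappa>_def)
    next
      case False
      then show ?thesis using 1 \<open>k \<noteq> 0\<close> by auto
    qed
  qed
  have w_nin: "vec.span {w} \<notin> range (\<lambda>t. vec.span {x t})"
  proof
    assume "vec.span {w} \<in> range (\<lambda>t. vec.span {x t})"
    then obtain t where "vec.span {w} = vec.span {x t}" by auto
    moreover have "w \<noteq> 0" using T' by auto
    ultimately obtain k where "x t = k *s w" using span_sing_eq_iff by blast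
    then have "(- t * b v w) *s u + \<kappa> t *s v + (\<kappa> t * t) *s w = 0 *s u + 0 *s v + k *s w"
      by (simp add: x_def)
    from coord[OF this] show False using T' by (auto simp: \<kappa>_def)
  qed
  have "insert (vec.span {w}) (range (\<lambda>t. vec.span {x t})) \<subseteq> quadric_in f ?W"
  proof -
    have "w \<in> ?W" "w \<noteq> 0" using T' by (auto simp: vec.span_base)
    then show ?thesis using x_W x_f x_0 T' in_quadric_in_iff[OF vec.subspace_span] by blast
  qed
  then have "card (insert (vec.span {w}) (range (\<lambda>t. vec.span {x t}))) \<le> card (quadric_in f ?W)"
    by (intro card_mono) auto
  moreover have "card (range (\<lambda>t. vec.span {x t})) = CARD('a)" using inj by (rule card_image)
  ultimately show ?thesis using w_nin by simp
qed

section \<open>External lines, that is, anisotropic two-dimensional subspaces\<close>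

definition external_line :: "('a ^ 6) set \<Rightarrow> bool" where
  "external_line l \<longleftrightarrow> vec.subspace l \<and> vec.dim l = 2 \<and> (\<forall>x\<in>l. f x = 0 \<longrightarrow> x = 0)"

lemma external_line_subspace: "external_line l \<Longrightarrow> vec.subspace l"
  and external_line_dim: "external_line l \<Longrightarrow> vec.dim l = 2"
  and external_line_0: "external_line l \<Longrightarrow> x \<in> l \<Longrightarrow> f x = 0 \<Longrightarrow> x = 0"
  by (auto simp: external_line_def)

lemma external_line_other:
  assumes l: "external_line l"
  shows "\<exists>y\<in>l. \<forall>k. y \<noteq> k *s x"
proof (rule ccontr)
  assume "\<not> ?thesis"
  then have "l \<subseteq> vec.span {x}" by (force simp: vec.span_singleton)
  then have "vec.dim l \<le> vec.dim {x}" by (rule vec.dim_mono)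
  then show False using external_line_dim[OF l] by (simp split: if_splits)
qed

text \<open>In odd characteristic \<open>b x x = 2 * f x\<close> is nonzero. In characteristic 2
  every field element is a square, so a nonzero radical vector \<open>x\<close> could be scaled and
  added to an independent \<open>y\<close> to give a singular vector.\<close>

lemma external_line_nondegenerate:
  assumes l: "external_line l" and x: "x \<in> l" "\<And>y. y \<in> l \<Longrightarrow> b x y = 0"
  shows "x = 0"
proof (rule ccontr)
  assume "x \<noteq> 0"
  then have fx: "f x \<noteq> 0" using external_line_0[OF l x(1)] by auto
  then have 2: "(2::'a) = 0" using x(2)[OF x(1)] by (simp add: b_self)
  obtain y where y: "y \<in> l" "\<And>k. y \<noteq> k *s x" using external_line_other[OF l] by blast
  obtain k where k: "k\<^sup>2 = - f y / f x" using finite_field_char2_square[OF 2] by blast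
  have "f (k *s x + y) = 0" using fx x(2)[OF y(1)] by (simp add: f_simps b_simps k)
  moreover have "k *s x + y \<in> l"
    using x(1) y(1) external_line_subspace[OF l] by (simp add: vec.subspace_add vec.subspace_scale)
  ultimately have "k *s x + y = 0" using external_line_0[OF l] by blast
  then have "y = (- k) *s x" by (simp add: add_eq_0_iff2 add_eq_0_iff)
  then show False using y(2) by blast
qed

lemma external_line_neg_value:
  assumes m: "external_line m"
  shows "\<exists>g\<in>m. \<exists>g'\<in>m. g \<noteq> 0 \<and> f g' = - f g"
proof -
  obtain g where g: "g \<in> m" "g \<noteq> 0" using external_line_other[OF m, of 0] by auto
  have fg: "f g \<noteq> 0" using g external_line_0[OF m] by auto
  show ?thesis
  proof (cases "(2::'a) = 0")
    case True
    then have "f g + f g = 0" by (metis mult_2 mult_zero_left)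
    then show ?thesis using g by (metis add_eq_0_iff2)
  next
    case False
    obtain y where y: "y \<in> m" "\<And>k. y \<noteq> k *s g" using external_line_other[OF m] by blast
    \<comment> \<open>Gram-Schmidt: \<open>d\<close> is the part of \<open>y\<close> orthogonal to
      \<open>g\<close>, which makes the form diagonal in \<open>g\<close> and
      \<open>d\<close>.\<close>
    define d where "d = y - (b g y / (2 * f g)) *s g"
    have d: "d \<in> m" "d \<noteq> 0"
      using y g external_line_subspace[OF m]
      by (auto simp: d_def vec.subspace_diff vec.subspace_scale)
    have gd: "b g d = 0" using fg False by (simp add: d_def b_simps b_self)
    have fd: "f d \<noteq> 0" using d external_line_0[OF m] by auto
    obtain s t where "f g * s\<^sup>2 + f d * t\<^sup>2 = - f g"
      using finite_field_binary_form_universal[OF False fg fd] by blast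
    then have "f (s *s g + t *s d) = - f g" using gd by (simp add: f_simps b_simps mult.commute)
    moreover have "s *s g + t *s d \<in> m"
      using g d external_line_subspace[OF m] by (simp add: vec.subspace_add vec.subspace_scale)
    ultimately show ?thesis using g by blast
  qed
qed

text \<open>The vectors \<open>h1\<close>, \<open>h2\<close> are the images of the basis
  \<open>g1\<close>, \<open>g2\<close> under a similitude of \<open>m\<close> with factor -1.
  Identifying \<open>m\<close> with the quadratic extension field so that \<open>g\<close> becomes 1
  and \<open>f\<close> a multiple of the norm, it is multiplication by the element of norm -1 that
  corresponds to \<open>g'\<close>. If that element lies in the ground field, it is a scalar
  \<open>k\<close> with \<open>k * k = -1\<close>.\<close>

lemma external_line_anti_isometry:
  assumes m: "external_line m"
  obtains g1 g2 h1 h2 where "g1 \<in> m" "g2 \<in> m" "h1 \<in> m" "h2 \<in> m" "g1 \<noteq> 0" "\<And>k. g2 \<noteq> k *s g1"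
    "f h1 = - f g1" "f h2 = - f g2" "b h1 h2 = - b g1 g2"
proof -
  obtain g g' where g: "g \<in> m" "g' \<in> m" "g \<noteq> 0" "f g' = - f g"
    using external_line_neg_value[OF m] by blast
  have fg: "f g \<noteq> 0" using g external_line_0[OF m] by auto
  note sub = external_line_subspace[OF m]
  show ?thesis
  proof (cases "\<exists>k. g' = k *s g")
    case True
    then obtain k where k: "g' = k *s g" by blast
    then have "(k * k) * f g = (-1) * f g" using g(4) by (simp add: f_scale power2_eq_square)
    then have k2: "k * k = -1" using fg by (simp only: mult_cancel_right) simp
    obtain y where y: "y \<in> m" "\<And>k. y \<noteq> k *s g" using external_line_other[OF m] by blast
    have "k * (k * b g y) = - b g y" using k2 by (metis mult.assoc mult_minus1)
    then show ?thesis using g y k2 sub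
      by (intro that[of g y "k *s g" "k *s y"])
        (auto simp: vec.subspace_scale f_scale b_simps power2_eq_square)
  next
    case False
    \<comment> \<open>The element has norm -1 and trace \<open>?\<beta> / f g\<close>, so its
      quadratic equation gives the image of \<open>g'\<close> as
      \<open>g + (?\<beta> / f g) *s g'\<close>.\<close>
    let ?\<beta> = "b g g'"
    have "f (g + (?\<beta> / f g) *s g') = - f g'"
      using fg g(4) by (simp add: f_simps b_simps power2_eq_square field_simps)
    moreover have "b g' (g + (?\<beta> / f g) *s g') = - ?\<beta>"
      using fg g(4) by (simp add: b_simps b_self b_commute field_simps)
    ultimately show ?thesis using g False sub
      by (intro that[of g g' g' "g + (?\<beta> / f g) *s g'"])
        (auto simp: vec.subspace_scale vec.subspace_add)
  qed
qed

lemma span_Un_subspaces: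
  assumes "vec.subspace U" "vec.subspace W"
  shows "x \<in> vec.span (U \<union> W) \<longleftrightarrow> (\<exists>u\<in>U. \<exists>w\<in>W. x = u + w)"
  using assms by (auto simp: vec.span_Un) (metis vec.span_eq_iff)+

lemma proj_join_iff:
  assumes "vec.subspace U" "vec.subspace W"
  shows "x \<in> proj_join U W \<longleftrightarrow> (\<exists>u\<in>U. \<exists>w\<in>W. x = u + w)"
  unfolding proj_join_def by (rule span_Un_subspaces[OF assms])

end

section \<open>The solid \<open>S\<close> spanned by two orthogonal external lines, and its polar
  line \<open>m\<close>\<close>

locale orthogonal_external_lines = elliptic_form +
  fixes l1 l2 :: "('a ^ 6) set"
  assumes l1: "external_line l1" and l2: "external_line l2"
    and l12: "x \<in> l1 \<Longrightarrow> y \<in> l2 \<Longrightarrow> b x y = 0"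
begin

definition S :: "('a ^ 6) set" where "S = vec.span (l1 \<union> l2)"

abbreviation m :: "('a ^ 6) set" where "m \<equiv> perp f S"

lemma l12': "x \<in> l2 \<Longrightarrow> y \<in> l1 \<Longrightarrow> b x y = 0"
  using l12 b_commute by metis

lemmas subspace_l1 = external_line_subspace[OF l1]
lemmas subspace_l2 = external_line_subspace[OF l2]

lemma in_S_iff: "x \<in> S \<longleftrightarrow> (\<exists>u\<in>l1. \<exists>w\<in>l2. x = u + w)"
  unfolding S_def by (rule span_Un_subspaces[OF subspace_l1 subspace_l2])

lemma l1_S: "l1 \<subseteq> S" and l2_S: "l2 \<subseteq> S"
  unfolding S_def by (auto simp: vec.span_base)

lemma subspace_S: "vec.subspace S" by (simp add: S_def)

lemma l1_Int_l2: "x \<in> l1 \<Longrightarrow> x \<in> l2 \<Longrightarrow> x = 0"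
  using external_line_nondegenerate[OF l1, of x] l12' by blast

lemma dim_S: "vec.dim S = 4"
proof -
  have "S = {x + y |x y. x \<in> l1 \<and> y \<in> l2}" using in_S_iff by blast
  then have "vec.dim S + vec.dim (l1 \<inter> l2) = 4"
    using vec.dim_sums_Int[OF subspace_l1 subspace_l2] external_line_dim l1 l2 by simp
  moreover have "vec.dim (l1 \<inter> l2) = 0" using l1_Int_l2 by (subst vec.dim_eq_0) auto
  ultimately show ?thesis by simp
qed

lemma dim_m: "vec.dim m = 2"
  using dim_perp[OF subspace_S] dim_S by simp

lemma m_orth: "x \<in> m \<Longrightarrow> y \<in> S \<Longrightarrow> b x y = 0"
  by (auto simp: perp_def b_commute)

lemma S_nondegenerate:
  assumes "x \<in> S" "\<And>y. y \<in> S \<Longrightarrow> b x y = 0"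
  shows "x = 0"
proof -
  obtain u w where x: "x = u + w" "u \<in> l1" "w \<in> l2" using assms(1) in_S_iff by blast
  have "b u y = 0" if "y \<in> l1" for y
    using assms(2)[of y] that l1_S l12'[OF x(3) that] by (auto simp: x(1) b_simps)
  moreover have "b w y = 0" if "y \<in> l2" for y
    using assms(2)[of y] that l2_S l12[OF x(2) that] by (auto simp: x(1) b_simps)
  ultimately show ?thesis
    using external_line_nondegenerate[OF l1 x(2)] external_line_nondegenerate[OF l2 x(3)] x(1) by simp
qed

lemma m_nondegenerate:
  assumes "x \<in> m" "\<And>y. y \<in> m \<Longrightarrow> b x y = 0"
  shows "x = 0"
proof -
  have "x \<in> perp f m" using assms(2) by (auto simp: perp_def b_commute)
  then have "x \<in> S" using perp_perp[OF subspace_S] by simp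
  then show ?thesis using S_nondegenerate m_orth[OF assms(1)] by blast
qed

lemma l2_eq: "perp f l1 \<inter> S = l2"
proof (intro equalityI subsetI)
  fix x assume x: "x \<in> perp f l1 \<inter> S"
  then obtain u w where uw: "x = u + w" "u \<in> l1" "w \<in> l2" using in_S_iff by blast
  have "b u y = 0" if "y \<in> l1" for y
    using x that l12'[OF uw(3) that] by (auto simp: perp_def uw(1) b_simps b_commute[of y])
  then have "u = 0" using external_line_nondegenerate[OF l1 uw(2)] by blast
  then show "x \<in> l2" using uw by simp
qed (use l2_S l12 in \<open>auto simp: perp_def\<close>)

text \<open>A totally singular line of \<open>l + m\<close> is the graph of an anti-isometry from \<open>m\<close> to \<open>l\<close>.\<close>

lemma totally_singular_graph:
  assumes l: "external_line l" "l \<subseteq> S"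
    and z: "z = a + x" "z' = a' + x'" "a \<in> l" "a' \<in> l" "x \<in> m" "x' \<in> m"
    and sing: "f z = 0" "f z' = 0" "b z z' = 0" and indep: "z \<noteq> 0" "\<And>k. z' \<noteq> k *s z"
  shows "external_line m" "y \<in> m \<Longrightarrow> \<exists>d\<in>l. d + y \<in> vec.span {z, z'}"
proof -
  have sub: "vec.subspace l" using l(1) by (rule external_line_subspace)
  have zero: "f y = 0" if "y \<in> vec.span {z, z'}" for y
    using that sing by (auto simp: in_span2 f_simps b_simps)
  have zero_b: "b y y' = 0" if "y \<in> vec.span {z, z'}" "y' \<in> vec.span {z, z'}" for y y'
  proof -
    have "totally_singular f (vec.span {z, z'})" using zero by (simp add: totally_singular_def)
    then show ?thesis using totally_singular_0 that by blast
  qed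
  \<comment> \<open>A combination of \<open>z\<close> and \<open>z'\<close> without component in
    \<open>m\<close> is a singular vector of the external line \<open>l\<close>, hence 0. So the
    components \<open>x\<close>, \<open>x'\<close> are independent and span
    \<open>m\<close>.\<close>
  have no_l: "s = 0 \<and> t = 0" if st: "s *s x + t *s x' = 0" for s t
  proof -
    have eq: "s *s z + t *s z' = s *s a + t *s a'"
    proof -
      have "s *s z + t *s z' = s *s a + t *s a' + (s *s x + t *s x')"
        by (simp add: z(1,2) vec.scale_right_distrib)
      then show ?thesis using st by simp
    qed
    have "s *s a + t *s a' \<in> l" using z sub by (simp add: vec.subspace_add vec.subspace_scale)
    moreover have "f (s *s z + t *s z') = 0" by (rule zero) (auto simp: in_span2)
    ultimately have 0: "s *s z + t *s z' = 0" using external_line_0[OF l(1)] eq by metis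
    have "t = 0"
    proof (rule ccontr)
      assume "t \<noteq> 0"
      have "t *s z' = - s *s z" using 0 by (simp add: add_eq_0_iff2 add_eq_0_iff)
      then have "(1/t) *s (t *s z') = (1/t) *s (- s *s z)" by simp
      then have "z' = (- s / t) *s z" using \<open>t \<noteq> 0\<close> by (simp add: vector_smult_assoc)
      then show False using indep by blast
    qed
    then show ?thesis using 0 indep by simp
  qed
  have "vec.dim (vec.span {x, x'}) = 2"
  proof (rule dim_span2)
    show "x \<noteq> 0" using no_l[of 1 0] by auto
    fix k show "x' \<noteq> k *s x" using no_l[of k "-1"] by auto
  qed
  moreover have "vec.span {x, x'} \<subseteq> m" using z by (intro vec.span_minimal subspace_perp) auto
  ultimately have m_eq: "vec.span {x, x'} = m"
    by (intro vec.subspace_dim_equal) (auto simp: dim_m subspace_perp)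
  have graph: "\<exists>d\<in>l. d + y \<in> vec.span {z, z'}" if y: "y \<in> m" for y
  proof -
    obtain s t where y: "y = s *s x + t *s x'" using y m_eq in_span2 by metis
    have "s *s a + t *s a' \<in> l" using z sub by (simp add: vec.subspace_add vec.subspace_scale)
    moreover have "(s *s a + t *s a') + y = s *s z + t *s z'"
      by (simp add: y z(1,2) vec.scale_right_distrib)
    ultimately show ?thesis using in_span2 by metis
  qed
  then show "y \<in> m \<Longrightarrow> \<exists>d\<in>l. d + y \<in> vec.span {z, z'}" .
  \<comment> \<open>Over a singular \<open>r\<close> the component \<open>d\<close> in
    \<open>l\<close> is singular as well, hence 0. Then \<open>r\<close> itself lies on the totally
    singular line, is therefore orthogonal to all of \<open>m\<close>, and vanishes.\<close>
  have "r = 0" if r: "r \<in> m" "f r = 0" for r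
  proof -
    obtain d where d: "d \<in> l" "d + r \<in> vec.span {z, z'}" using graph r by blast
    have ortho: "b r d' = 0" if "d' \<in> l" for d' using m_orth r l(2) that by blast
    have "f d = 0" using zero[OF d(2)] r ortho[OF d(1)] by (simp add: f_add b_commute)
    then have "d = 0" using external_line_0[OF l(1) d(1)] by simp
    then have r_in: "r \<in> vec.span {z, z'}" using d by simp
    have "b r y = 0" if y: "y \<in> m" for y
    proof -
      obtain d' where "d' \<in> l" "d' + y \<in> vec.span {z, z'}" using graph y by blast
      then show ?thesis using zero_b[OF r_in, of "d' + y"] ortho by (simp add: b_simps)
    qed
    then show "r = 0" using m_nondegenerate r by blast
  qed
  then show "external_line m" by (simp add: external_line_def dim_m subspace_perp)
qed

text \<open>\<open>L1\<close> and \<open>L2\<close> are graphs of anti-isometries from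
  \<open>m\<close> to \<open>l1\<close> and \<open>l2\<close>. Precomposing the second one with a
  similitude of factor -1 makes it an isometry, so sums of corresponding images are singular and
  fill a line of \<open>S\<close>.\<close>

lemma hyperbolic_S:
  assumes m: "external_line m"
    and L1: "totally_singular f L1" "\<And>y. y \<in> m \<Longrightarrow> \<exists>d\<in>l1. d + y \<in> L1"
    and L2: "totally_singular f L2" "\<And>y. y \<in> m \<Longrightarrow> \<exists>d\<in>l2. d + y \<in> L2"
  shows "hyperbolic_on f S"
proof -
  obtain g1 g2 h1 h2 where g: "g1 \<in> m" "g2 \<in> m" "h1 \<in> m" "h2 \<in> m" "g1 \<noteq> 0" "\<And>k. g2 \<noteq> k *s g1"
    "f h1 = - f g1" "f h2 = - f g2" "b h1 h2 = - b g1 g2"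
    by (rule external_line_anti_isometry[OF m]) (rule that, assumption+)
  obtain a1 a2 b1 b2 where ab: "a1 \<in> l1" "a1 + g1 \<in> L1" "a2 \<in> l1" "a2 + g2 \<in> L1"
    "b1 \<in> l2" "b1 + h1 \<in> L2" "b2 \<in> l2" "b2 + h2 \<in> L2"
    using L1(2)[OF g(1)] L1(2)[OF g(2)] L2(2)[OF g(3)] L2(2)[OF g(4)] by blast
  have mo: "b y x = 0" "b x y = 0" if "y \<in> m" "x \<in> l1 \<union> l2" for x y
    using m_orth[of y x] that l1_S l2_S b_commute[of x y] by auto
  have fa: "f a1 = - f g1" "f a2 = - f g2" "f b1 = f g1" "f b2 = f g2"
  proof -
    have z: "f (a1 + g1) = 0" "f (a2 + g2) = 0" "f (b1 + h1) = 0" "f (b2 + h2) = 0"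
      using L1(1) L2(1) ab unfolding totally_singular_def by blast+
    have "b a1 g1 = 0" "b a2 g2 = 0" "b b1 h1 = 0" "b b2 h2 = 0"
      using mo(2) g ab by auto
    then show "f a1 = - f g1" "f a2 = - f g2" "f b1 = f g1" "f b2 = f g2"
      using z g(7,8) by (simp_all add: f_add eq_neg_iff_add_eq_0)
  qed
  have ba: "b a1 a2 = - b g1 g2" "b b1 b2 = b g1 g2"
  proof -
    have "b a1 g2 = 0" "b g1 a2 = 0" "b b1 h2 = 0" "b h1 b2 = 0" using mo g ab by auto
    then show "b a1 a2 = - b g1 g2" "b b1 b2 = b g1 g2"
      using totally_singular_0[OF L1(1) ab(2,4)] totally_singular_0[OF L2(1) ab(6,8)] g(9)
      by (simp_all add: b_simps eq_neg_iff_add_eq_0)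
  qed
  define y1 y2 where "y1 = a1 + b1" and "y2 = a2 + b2"
  have y: "f y1 = 0" "f y2 = 0" "b y1 y2 = 0"
    using fa ba ab l12 l12' by (auto simp: y1_def y2_def f_add b_simps)
  have cross: "u = 0 \<and> w = 0" if "u + w = 0" "u \<in> l1" "w \<in> l2" for u w
  proof -
    have "u = - w" using that by (simp add: add_eq_0_iff2)
    then have "u \<in> l2" using that subspace_l2 vec.subspace_neg by blast
    then have "u = 0" using l1_Int_l2 that by blast
    then show ?thesis using that by simp
  qed
  have "y1 \<noteq> 0"
  proof
    assume "y1 = 0"
    then have "a1 = 0" using cross[of a1 b1] ab by (simp add: y1_def)
    then show False using fa(1) external_line_0[OF m g(1)] g(5) by simp
  qed
  \<comment> \<open>Dependence would give \<open>a2 = k *s a1\<close>, so that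
    \<open>g2 - k *s g1\<close> would lie in both \<open>L1\<close> and \<open>m\<close>, a nonzero
    singular vector of an external line.\<close>
  moreover have "y2 \<noteq> k *s y1" for k
  proof
    assume "y2 = k *s y1"
    then have "(a2 - k *s a1) + (b2 - k *s b1) = 0" by (simp add: y1_def y2_def vec.scale_right_distrib) (simp add: algebra_simps)
    then have "a2 - k *s a1 = 0"
      using cross[of "a2 - k *s a1" "b2 - k *s b1"] ab subspace_l1 subspace_l2
      by (auto simp: vec.subspace_diff vec.subspace_scale)
    then have "(a2 + g2) - k *s (a1 + g1) = g2 - k *s g1" by (simp add: vec.scale_right_distrib)
    moreover have "(a2 + g2) - k *s (a1 + g1) \<in> L1"
      using ab(2,4) L1(1) unfolding totally_singular_def
      by (meson vec.subspace_diff vec.subspace_scale)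
    ultimately have "f (g2 - k *s g1) = 0" using L1(1) by (auto simp: totally_singular_def)
    moreover have "g2 - k *s g1 \<in> m" using g subspace_perp by (simp add: vec.subspace_diff vec.subspace_scale)
    ultimately have "g2 - k *s g1 = 0" using external_line_0[OF m] by blast
    then show False using g(6)[of k] by simp
  qed
  ultimately have dim: "vec.dim (vec.span {y1, y2}) = 2" by (rule dim_span2)
  have "f x = 0" if "x \<in> vec.span {y1, y2}" for x
    using that y by (auto simp: in_span2 f_simps b_simps)
  then have "totally_singular f (vec.span {y1, y2})" by (simp add: totally_singular_def)
  moreover have "vec.span {y1, y2} \<subseteq> S"
    by (rule vec.span_minimal[OF _ subspace_S]) (use ab in_S_iff in \<open>auto simp: y1_def y2_def\<close>)
  ultimately have "witt_index f S = 2" using dim totally_singular_dim_le by (rule witt_index_eqI)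
  moreover have "nonsingular_on f S" using S_nondegenerate by (auto simp: nonsingular_on_def)
  ultimately show ?thesis by (simp add: hyperbolic_on_def subspace_S dim_S)
qed

end

section \<open>The quadric outside a hyperplane\<close>

locale quadric_scheme = elliptic_form +
  fixes c :: "'a ^ 6"
  assumes c_nonsingular: "f c \<noteq> 0"
begin

section \<open>The hyperplane polar to \<open>c\<close> and the reflection that induces
  \<sigma>\<close>

definition hyp :: "('a ^ 6) set" where "hyp = {x. b c x = 0}"

text \<open>The orthogonal reflection with centre \<open>c\<close>. Dividing by \<open>f c\<close>
  keeps the formula valid in characteristic 2, where it is a transvection.\<close>

definition reflect :: "'a ^ 6 \<Rightarrow> 'a ^ 6" where "reflect x = x - (b c x / f c) *s c"

text \<open>Unlike \<open>collinear_pts\<close>, this relation is reflexive on the quadric, so the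
  counts of neighbours of a point of \<open>Z\<close> include the point itself.\<close>

definition orth :: "('a ^ 6) set \<Rightarrow> ('a ^ 6) set \<Rightarrow> bool" where
  "orth p r \<longleftrightarrow> r \<subseteq> perp f p"

abbreviation sig :: "('a ^ 6) set \<Rightarrow> ('a ^ 6) set" where "sig p \<equiv> reflect ` p"

lemma orth_span: "orth (vec.span {x}) (vec.span {y}) \<longleftrightarrow> b x y = 0"
  unfolding orth_def by (rule span_subset_perp_span)

lemma subspace_hyp: "vec.subspace hyp"
  by (auto simp: hyp_def vec.subspace_def b_simps)

lemma hyp_eq_perp: "hyp = perp f (vec.span {c})"
  by (auto simp: hyp_def in_perp_span_iff)

lemma reflect_add: "reflect (x + y) = reflect x + reflect y"
  by (simp add: reflect_def b_simps add_divide_distrib vec.scale_left_distrib)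

lemma reflect_scale: "reflect (k *s x) = k *s reflect x"
  by (simp add: reflect_def b_simps vec.scale_right_diff_distrib)

lemma f_reflect [simp]: "f (reflect x) = f x"
  using c_nonsingular
  by (simp add: reflect_def f_simps b_simps b_commute power2_eq_square)

lemma b_c_reflect: "b c (reflect x) = - b c x"
  using c_nonsingular by (simp add: reflect_def b_simps b_self)

lemma reflect_reflect [simp]: "reflect (reflect x) = x"
proof -
  have "reflect (reflect x) = reflect x + (b c x / f c) *s c"
    unfolding reflect_def[of "reflect x"] b_c_reflect by simp
  then show ?thesis by (simp add: reflect_def)
qed

lemma b_reflect [simp]: "b (reflect x) (reflect y) = b x y"
  by (simp add: polar_form_def flip: reflect_add)

lemma reflect_0 [simp]: "reflect 0 = 0"
  by (simp add: reflect_def)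

lemma reflect_eq_0_iff [simp]: "reflect x = 0 \<longleftrightarrow> x = 0"
  by (metis reflect_reflect reflect_0)

lemma reflect_hyp: "x \<in> hyp \<Longrightarrow> reflect x = x"
  by (simp add: hyp_def reflect_def)

lemma sig_span: "sig (vec.span {x}) = vec.span {reflect x}"
  by (force simp: vec.span_singleton reflect_scale)

lemma sig_sig [simp]: "sig (sig p) = p"
  by (simp add: image_image)

lemma orth_commute:
  assumes "p \<in> quadric f" "r \<in> quadric f"
  shows "orth p r \<longleftrightarrow> orth r p"
proof -
  obtain x y where "p = vec.span {x}" "r = vec.span {y}"
    using assms by (auto simp: in_quadric_iff)
  then show ?thesis by (simp only: orth_span b_commute)
qed

lemma in_quadric_minus_iff:
  "p \<in> quadric_minus f hyp \<longleftrightarrow> (\<exists>x. b c x \<noteq> 0 \<and> f x = 0 \<and> p = vec.span {x})"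
proof -
  have "p \<in> quadric_minus f hyp \<longleftrightarrow> p \<in> quadric f \<and> \<not> p \<subseteq> hyp"
    by (auto simp: quadric_minus_def quadric_in_def)
  also have "\<dots> \<longleftrightarrow> (\<exists>x. x \<noteq> 0 \<and> f x = 0 \<and> p = vec.span {x} \<and> x \<notin> hyp)"
    using span_subset_iff[OF subspace_hyp] by (auto simp: in_quadric_iff)
  also have "\<dots> \<longleftrightarrow> (\<exists>x. b c x \<noteq> 0 \<and> f x = 0 \<and> p = vec.span {x})"
    unfolding hyp_def mem_Collect_eq by (metis b_0_right)
  finally show ?thesis .
qed

lemma quadric_minusD: "p \<in> quadric_minus f hyp \<Longrightarrow> p \<in> quadric f"
  by (simp add: quadric_minus_def)

lemma orth_refl: "p \<in> quadric f \<Longrightarrow> orth p p"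
proof -
  assume "p \<in> quadric f"
  then obtain x where "f x = 0" "p = vec.span {x}" by (auto simp: in_quadric_iff)
  then show ?thesis by (simp only: orth_span) (simp add: b_self)
qed

lemma sig_quadric_minus: "p \<in> quadric_minus f hyp \<Longrightarrow> sig p \<in> quadric_minus f hyp"
proof -
  assume "p \<in> quadric_minus f hyp"
  then obtain x where x: "b c x \<noteq> 0" "f x = 0" "p = vec.span {x}"
    by (auto simp: in_quadric_minus_iff)
  then show ?thesis unfolding in_quadric_minus_iff sig_span x(3)
    by (intro exI[of _ "reflect x"]) (auto simp: b_c_reflect)
qed

text \<open>If \<open>x\<close> is orthogonal to \<open>y\<close> and to \<open>reflect y\<close>,
  it is orthogonal to their difference, a multiple of \<open>c\<close>; as \<open>b c x\<close> is
  nonzero, that multiple is 0.\<close>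

lemma not_orth_sig:
  assumes "p \<in> quadric_minus f hyp" "r \<in> quadric f" "orth p r" "orth p (sig r)"
  shows "r \<subseteq> hyp"
proof -
  obtain x where x: "b c x \<noteq> 0" "f x = 0" "p = vec.span {x}"
    using assms by (auto simp: in_quadric_minus_iff)
  obtain y where y: "f y = 0" "r = vec.span {y}" using assms by (auto simp: in_quadric_iff)
  have "b x y = 0" "b x (reflect y) = 0" using assms x y by (auto simp: orth_span sig_span)
  then have "b c y = 0" using x c_nonsingular by (auto simp: reflect_def b_simps b_commute)
  then show ?thesis using y by (simp add: hyp_def[symmetric] span_subset_iff[OF subspace_hyp]) (simp add: hyp_def)
qed

lemma not_orth_sig':
  assumes "p \<in> quadric_minus f hyp" "r \<in> quadric_minus f hyp" "orth p r"
  shows "\<not> orth p (sig r)"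
  using not_orth_sig[OF assms(1) _ assms(3)] assms(2)
  by (auto simp: quadric_minus_def quadric_in_def)

lemma sig_neq: "p \<in> quadric_minus f hyp \<Longrightarrow> sig p \<noteq> p"
  using not_orth_sig'[of p p] orth_refl[OF quadric_minusD] by auto

lemma orth_hyp_sig:
  assumes "h \<in> quadric_in f hyp" "p \<in> quadric f" "orth h p"
  shows "orth h (sig p)"
proof -
  obtain x where x: "x \<in> hyp" "h = vec.span {x}"
    using assms(1) in_quadric_in_iff[OF subspace_hyp] by blast
  obtain y where y: "p = vec.span {y}" using assms(2) by (auto simp: in_quadric_iff)
  have "b x y = 0" using assms(3) unfolding x y orth_span .
  moreover have "b x (reflect y) = b x y" by (metis b_reflect reflect_hyp x(1))
  ultimately show ?thesis unfolding x y sig_span orth_span by simp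
qed

lemma inj_sig: "inj sig"
  by (metis injI sig_sig)

lemma card_sig: "card (sig ` A) = card A"
  by (rule card_image[OF inj_on_subset[OF inj_sig subset_UNIV]])

lemma triad_reflect: "triad u v w \<Longrightarrow> triad (reflect u) (reflect v) (reflect w)"
  by (simp add: triad_def)

lemma reflect_span3: "reflect ` vec.span {u, v, w} = vec.span {reflect u, reflect v, reflect w}"
proof -
  have "reflect (r *s u + s *s v + t *s w) = r *s reflect u + s *s reflect v + t *s reflect w" for r s t
    by (simp add: reflect_add reflect_scale)
  then have "y \<in> reflect ` vec.span {u, v, w} \<longleftrightarrow> y \<in> vec.span {reflect u, reflect v, reflect w}" for y
    unfolding image_iff Bex_def in_span3 by metis
  then show ?thesis by blast
qed

lemma quadric_in_reflect:
  assumes "vec.subspace U" "vec.subspace (reflect ` U)"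
  shows "quadric_in f (reflect ` U) = sig ` quadric_in f U"
proof (intro equalityI subsetI)
  fix p assume "p \<in> quadric_in f (reflect ` U)"
  then obtain x where x: "x \<in> U" "reflect x \<noteq> 0" "f (reflect x) = 0" "p = vec.span {reflect x}"
    using in_quadric_in_iff[OF assms(2)] by auto
  then have "vec.span {x} \<in> quadric_in f U" using in_quadric_in_iff[OF assms(1)] by auto
  then show "p \<in> sig ` quadric_in f U" using x sig_span[of x] by (metis imageI)
next
  fix p assume "p \<in> sig ` quadric_in f U"
  then obtain x where x: "x \<in> U" "x \<noteq> 0" "f x = 0" "p = vec.span {reflect x}"
    using in_quadric_in_iff[OF assms(1)] by (auto simp: sig_span)
  then show "p \<in> quadric_in f (reflect ` U)"
    unfolding in_quadric_in_iff[OF assms(2)] by (intro bexI[of _ "reflect x"]) auto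
qed

section \<open>Conic planes relative to the hyperplane, and the action of \<sigma> off the
  quadric\<close>

lemma perp_hyp: "perp f hyp = vec.span {c}"
  unfolding hyp_eq_perp by (rule perp_perp) simp

text \<open>The vector \<open>e\<close> spans the pole, within \<open>W\<close>, of the line cut out
  by \<open>hyp\<close>. It is not in \<open>hyp\<close> because that line is nondegenerate, so
  \<open>W\<close> is the orthogonal sum of the line and the point of \<open>e\<close>.\<close>

lemma conic_plane_decomposition:
  assumes T: "triad u v w" and W: "W = vec.span {u, v, w}"
    and ext: "\<And>x. x \<in> W \<Longrightarrow> f x = 0 \<Longrightarrow> b c x = 0 \<Longrightarrow> x = 0"
  obtains a e where "external_line (W \<inter> hyp)" "u = a + e" "a \<in> W \<inter> hyp" "a \<noteq> 0" "e \<in> W"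
    "b c e \<noteq> 0" "\<And>x. x \<in> W \<inter> hyp \<Longrightarrow> b e x = 0"
    "\<And>x. x \<in> W \<Longrightarrow> \<exists>k. x - k *s e \<in> W \<inter> hyp"
proof -
  note T' = triadD[OF T]
  let ?l = "W \<inter> hyp"
  have subW: "vec.subspace W" by (simp add: W)
  have subl: "vec.subspace ?l" using subW subspace_hyp by (rule vec.subspace_inter)
  have dimW: "vec.dim W = 3" using triad_dim[OF T] by (simp add: W)
  have uW: "u \<in> W" "v \<in> W" "w \<in> W" by (auto simp: W vec.span_base)
  have cu: "b c u \<noteq> 0" using ext[OF uW(1)] T' by auto
  have ge: "vec.dim W \<le> vec.dim ?l + 1"
    using dim_Int_perp_ge[OF subW, of "vec.span {c}"] c_nonsingular
    by (auto simp: hyp_eq_perp split: if_splits)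
  have "?l \<noteq> W" using uW(1) cu by (auto simp: hyp_def)
  then have "vec.dim ?l \<noteq> 3" using vec.subspace_dim_equal[OF subl subW] dimW by auto
  moreover have "vec.dim ?l \<le> 3" using vec.dim_subset[of ?l W] dimW by simp
  ultimately have dl: "vec.dim ?l = 2" using ge dimW by linarith
  have l: "external_line ?l"
    using ext subl dl by (auto simp: external_line_def hyp_def)
  have "vec.dim W \<le> vec.dim (W \<inter> perp f ?l) + vec.dim ?l" by (rule dim_Int_perp_ge[OF subW])
  then have "vec.dim (W \<inter> perp f ?l) \<noteq> 0" using dimW dl by linarith
  then have "\<not> W \<inter> perp f ?l \<subseteq> {0}" by (simp only: vec.dim_eq_0 simp_thms)
  then obtain e0 where e0: "e0 \<in> W" "e0 \<in> perp f ?l" "e0 \<noteq> 0" by blast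
  have e0l: "b e0 x = 0" if "x \<in> ?l" for x
    using e0(2) that b_commute[of e0 x] by (simp add: perp_def)
  have ce0: "b c e0 \<noteq> 0"
  proof
    assume "b c e0 = 0"
    then have "e0 \<in> ?l" using e0 by (simp add: hyp_def)
    then show False using external_line_nondegenerate[OF l] e0l e0(3) by blast
  qed
  have decomp: "x - (b c x / b c e0) *s e0 \<in> ?l" if "x \<in> W" for x
    using that e0 ce0 subW by (auto simp: hyp_def b_simps vec.subspace_diff vec.subspace_scale)
  have fe0: "f e0 \<noteq> 0"
  proof
    assume 0: "f e0 = 0"
    have "b x e0 = 0" if "x \<in> W" for x
      using e0l[OF decomp[OF that]] 0 by (simp add: b_simps b_self b_commute)
    then show False using triad_nonsingular[OF T, of e0] e0 0 uW W by auto
  qed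
  \<comment> \<open>This scaling of \<open>e0\<close> makes \<open>u - k *s e0\<close> fall into the
    hyperplane.\<close>
  define k where "k = b c u / b c e0"
  have k: "k \<noteq> 0" using cu ce0 by (simp add: k_def)
  show ?thesis
  proof (rule that[OF l, of "u - k *s e0" "k *s e0"])
    show "u - k *s e0 \<in> ?l" using decomp[OF uW(1)] by (simp add: k_def)
    show "u - k *s e0 \<noteq> 0"
    proof
      assume "u - k *s e0 = 0"
      then have "f u = k\<^sup>2 * f e0" by (simp add: f_scale)
      then show False using k fe0 T' by simp
    qed
    show "k *s e0 \<in> W" using e0 subW by (simp add: vec.subspace_scale)
    show "b c (k *s e0) \<noteq> 0" using k ce0 by (simp add: b_simps)
    show "b (k *s e0) x = 0" if "x \<in> ?l" for x using e0l[OF that] by (simp add: b_simps)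
    show "\<exists>k'. x - k' *s (k *s e0) \<in> ?l" if "x \<in> W" for x
      using decomp[OF that] k
      by (intro exI[of _ "b c x / b c e0 / k"]) (simp add: vector_smult_assoc)
  qed simp
qed

text \<open>The involution is prescribed on the axis and on the points of \<open>X\<close>, whereas
  the point of \<open>e\<close> may lie on neither. It lies on the line through the fixed point
  \<open>a\<close> and the singular point \<open>a + e\<close>, which is mapped to the line through
  \<open>a\<close> and \<open>reflect e\<close>. The image also lies on the line through
  \<open>c\<close> and \<open>e\<close>, and the two lines meet only in
  \<open>reflect e\<close>.\<close>

lemma collineation_eq_sig:
  assumes coll: "central_collineation g hyp (vec.span {c})"
    and g_X: "\<And>p. p \<in> quadric_minus f hyp \<Longrightarrow> g p = sig p"
    and e: "b c e \<noteq> 0" and a: "a \<in> hyp" "a \<noteq> 0" "a \<notin> vec.span {c, e}" and z: "f (a + e) = 0"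
  shows "g (vec.span {e}) = sig (vec.span {e})"
proof -
  have e0: "e \<noteq> 0" using e by auto
  have pt_e: "proj_point (vec.span {e})" and pt_a: "proj_point (vec.span {a})"
    using e0 a proj_point_iff by blast+
  have ca: "b c a = 0" using a by (simp add: hyp_def)
  define L where "L = vec.span {a, e}"
  have "e \<noteq> k *s a" for k using e ca by (auto simp: b_simps)
  then have line_L: "proj_line L" using dim_span2[OF a(2)] by (simp add: L_def proj_subspace_def)
  have lines: "\<forall>l. proj_line l \<longrightarrow> (\<exists>M. proj_line M \<and>
      g ` {p. proj_point p \<and> p \<subseteq> l} = {p. proj_point p \<and> p \<subseteq> M})"
    using coll unfolding central_collineation_def collineation_def by (elim conjE)
  obtain M where M: "proj_line M"
    "g ` {p. proj_point p \<and> p \<subseteq> L} = {p. proj_point p \<and> p \<subseteq> M}"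
    by (rule exE[OF lines[rule_format, OF line_L]]) (erule conjE, rule that)
  have subM: "vec.subspace M" and dimM: "vec.dim M = 2" using M(1) by (auto simp: proj_subspace_def)
  have in_L: "a \<in> L" "e \<in> L" "a + e \<in> L" by (auto simp: L_def vec.span_base vec.span_add)
  have in_M: "g (vec.span {x}) \<subseteq> M \<and> proj_point (g (vec.span {x}))" if "x \<in> L" "x \<noteq> 0" for x
  proof -
    have "vec.span {x} \<in> {p. proj_point p \<and> p \<subseteq> L}"
      using that proj_point_iff span_subset_iff[of L x] by (auto simp: L_def)
    then show ?thesis using M(2) by blast
  qed
  have "g (vec.span {a}) = vec.span {a}"
    using coll pt_a a span_subset_iff[OF subspace_hyp] by (simp add: central_collineation_def)
  then have aM: "a \<in> M" using in_M[OF in_L(1) a(2)] span_subset_iff[OF subM] by simp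
  have cae: "b c (a + e) \<noteq> 0" using ca e by (simp add: b_simps)
  then have "vec.span {a + e} \<in> quadric_minus f hyp" using z in_quadric_minus_iff by blast
  then have "g (vec.span {a + e}) = vec.span {reflect (a + e)}" by (simp add: g_X sig_span)
  moreover have "a + e \<noteq> 0" using cae by force
  ultimately have "reflect (a + e) \<in> M" using in_M[OF in_L(3)] span_subset_iff[OF subM] by simp
  then have "(a + reflect e) - a \<in> M"
    using aM subM reflect_hyp[OF a(1)] by (metis reflect_add vec.subspace_diff)
  then have eM: "reflect e \<in> M" by simp
  have re: "reflect e \<in> vec.span {c, e}"
    unfolding reflect_def by (intro vec.span_diff vec.span_scale vec.span_base) auto
  have "vec.dim (vec.span {a, reflect e}) = 2"
  proof (rule dim_span2[OF a(2)])
    fix k show "reflect e \<noteq> k *s a"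
      using ca e b_c_reflect[of e] by (auto simp: b_simps)
  qed
  moreover have "vec.span {a, reflect e} \<subseteq> M"
    using aM eM by (intro vec.span_minimal[OF _ subM]) auto
  ultimately have M_eq: "vec.span {a, reflect e} = M"
    using vec.subspace_dim_equal[of "vec.span {a, reflect e}" M] subM dimM by simp
  obtain s where s: "s \<noteq> 0" "g (vec.span {e}) = vec.span {s}"
    using in_M[OF in_L(2) e0] proj_point_iff by blast
  have "s \<in> M" using in_M[OF in_L(2) e0] s span_subset_iff[OF subM] by simp
  then obtain \<alpha> \<beta> where s_eq: "s = \<alpha> *s a + \<beta> *s reflect e" using M_eq in_span2 by blast
  have "g (vec.span {e}) \<subseteq> proj_join (vec.span {c}) (vec.span {e})"
    using coll pt_e by (simp add: central_collineation_def)
  then have "vec.span {s} \<subseteq> proj_join (vec.span {c}) (vec.span {e})" by (simp only: s(2))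
  moreover have "proj_join (vec.span {c}) (vec.span {e}) \<subseteq> vec.span {c, e}"
    unfolding proj_join_def
    by (intro vec.span_minimal vec.subspace_span Un_least vec.span_mono) auto
  ultimately have "s \<in> vec.span {c, e}" using span_subset_iff[OF vec.subspace_span] by blast
  then have "s - \<beta> *s reflect e \<in> vec.span {c, e}" using re by (intro vec.span_diff vec.span_scale)
  then have \<alpha>a: "\<alpha> *s a \<in> vec.span {c, e}" by (simp add: s_eq)
  have "\<alpha> = 0"
  proof (rule ccontr)
    assume "\<alpha> \<noteq> 0"
    then have "a = (1 / \<alpha>) *s (\<alpha> *s a)" by (simp add: vector_smult_assoc)
    then show False using a(3) \<alpha>a vec.span_scale by metis
  qed
  then have "s = \<beta> *s reflect e" using s_eq by simp
  then have "vec.span {reflect e} = vec.span {s}" using span_sing_eq_iff[of "reflect e" s] s e0 by auto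
  then show ?thesis by (simp add: s sig_span)
qed

lemma proj_join_sig:
  assumes "vec.subspace p" and sp: "vec.subspace (sig p)" and "vec.subspace l" "l \<subseteq> hyp"
  shows "proj_join (sig p) l = reflect ` proj_join p l"
proof -
  have fix_l: "reflect x = x" if "x \<in> l" for x using that assms(4) reflect_hyp by blast
  have "y \<in> proj_join (sig p) l \<longleftrightarrow> y \<in> reflect ` proj_join p l" for y
    unfolding image_iff Bex_def proj_join_iff[OF sp assms(3)] proj_join_iff[OF assms(1,3)]
    by (metis fix_l reflect_add)
  then show ?thesis by blast
qed

end

section \<open>Sets with constant intersection numbers\<close>

lemma sum_card_swap:
  assumes "finite A" "finite B"
  shows "(\<Sum>x\<in>A. card {y \<in> B. P x y}) = (\<Sum>y\<in>B. card {x \<in> A. P x y})"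
proof -
  have "(\<Sum>x\<in>A. card {y \<in> B. P x y}) = (\<Sum>x\<in>A. \<Sum>y\<in>B. of_bool (P x y))"
    using assms by (simp add: Int_def)
  also have "\<dots> = (\<Sum>y\<in>B. \<Sum>x\<in>A. of_bool (P x y))" by (rule sum.swap)
  also have "\<dots> = (\<Sum>y\<in>B. card {x \<in> A. P x y})" using assms by (simp add: Int_def)
  finally show ?thesis .
qed

locale balanced_set = quadric_scheme +
  fixes Z :: "('a ^ 6) set set"
  assumes Z_subset: "Z \<subseteq> quadric_minus f hyp"
    and sig_Z: "p \<in> Z \<Longrightarrow> sig p \<in> Z"
    and card_Z: "card Z = 4 * (CARD('a) + 1)"
    and card_orth_minus: "p \<in> quadric_minus f hyp \<Longrightarrow>
      card {r \<in> Z. orth p r} = 4 + (if p \<in> Z then CARD('a) else 0)"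
    and field_card: "CARD('a) \<ge> 59"
begin

definition nbr :: "('a ^ 6) set \<Rightarrow> ('a ^ 6) set set" where "nbr p = {r \<in> Z. orth p r}"

lemma finite_Z [simp]: "finite Z"
  using card_Z card.infinite by fastforce

lemma finite_nbr [simp]: "finite (nbr p)"
  by (simp add: nbr_def)

lemma Z_minus: "p \<in> Z \<Longrightarrow> p \<in> quadric_minus f hyp"
  using Z_subset by auto

lemma Z_quadric: "p \<in> Z \<Longrightarrow> p \<in> quadric f"
  using Z_minus quadric_minusD by auto

lemma card_nbr_Z: "p \<in> Z \<Longrightarrow> card (nbr p) = CARD('a) + 4"
  using card_orth_minus[OF Z_minus, of p] by (simp add: nbr_def)

text \<open>\<open>L\<close> consists of the points outside \<open>hyp\<close> of a line of the
  quadric whose point in \<open>hyp\<close> is that of \<open>h0\<close>. The left side counts the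
  points of the whole line orthogonal to \<open>z\<close>: a single one, or all of them exactly when
  \<open>z\<close> is on the line, since there are no totally singular planes.\<close>

lemma card_line_minus_orth:
  assumes h0: "h0 \<in> hyp" "h0 \<noteq> 0" "f h0 = 0"
    and x0: "b c x0 \<noteq> 0" "f x0 = 0" "b h0 x0 = 0"
    and z: "z \<in> quadric_minus f hyp"
  defines "L \<equiv> range (\<lambda>t. vec.span {x0 + t *s h0})"
  shows "card {p \<in> L. orth p z} + of_bool (orth (vec.span {h0}) z)
    = 1 + (if z \<in> L then CARD('a) else 0)"
proof -
  have ch: "b c h0 = 0" using h0 by (simp add: hyp_def)
  have inj: "inj (\<lambda>t. vec.span {x0 + t *s h0})"
  proof (rule injI)
    fix t t' assume eq: "vec.span {x0 + t *s h0} = vec.span {x0 + t' *s h0}"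
    have "b c (x0 + t *s h0) \<noteq> 0" using x0 ch by (simp add: b_simps)
    then have "x0 + t *s h0 \<noteq> 0" by force
    then obtain k where k: "x0 + t' *s h0 = k *s (x0 + t *s h0)"
      using eq span_sing_eq_iff by blast
    then have "b c (x0 + t' *s h0) = b c (k *s (x0 + t *s h0))" by simp
    then have "k = 1" using x0 ch by (simp add: b_simps)
    with k show "t = t'" using h0 by simp
  qed
  obtain z1 where z1: "b c z1 \<noteq> 0" "f z1 = 0" "z = vec.span {z1}"
    using z by (auto simp: in_quadric_minus_iff)
  let ?T = "{t. b x0 z1 + t * b h0 z1 = 0}"
  have "{p \<in> L. orth p z} = (\<lambda>t. vec.span {x0 + t *s h0}) ` ?T"
    unfolding L_def z1(3) by (auto simp: orth_span b_simps image_iff)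
  then have card_T: "card {p \<in> L. orth p z} = card ?T"
    using inj by (simp add: card_image inj_on_subset)
  have zL: "z \<in> L \<longleftrightarrow> b x0 z1 = 0 \<and> b h0 z1 = 0"
  proof
    assume "z \<in> L"
    then obtain t where "z = vec.span {x0 + t *s h0}" by (auto simp: L_def)
    moreover have "z1 \<noteq> 0" using z1 by auto
    ultimately obtain k where "x0 + t *s h0 = k *s z1" "x0 + t *s h0 \<noteq> 0" 
      using span_sing_eq_iff z1(3) by blast
    then have k: "z1 = (1 / k) *s (x0 + t *s h0)" by (auto simp: vector_smult_assoc)
    show "b x0 z1 = 0 \<and> b h0 z1 = 0" 
      unfolding k using h0 x0 by (simp add: b_simps b_self b_commute)
  next
    assume *: "b x0 z1 = 0 \<and> b h0 z1 = 0"
    have nk: "x0 \<noteq> k *s h0" for k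
    proof
      assume "x0 = k *s h0"
      then have "b c x0 = k * b c h0" by (simp add: b_simps)
      then show False using x0 ch by simp
    qed
    have "z1 \<in> vec.span {h0, x0}"
      by (rule totally_singular_span3) (use h0 x0 z1 * nk in auto)
    then obtain s t where st: "z1 = s *s h0 + t *s x0" by (auto simp: in_span2)
    then have "b c z1 = t * b c x0" using ch by (simp add: b_simps)
    then have "t \<noteq> 0" using z1 by auto
    then have "z1 = t *s (x0 + (s / t) *s h0)"
      using st by (simp add: vec.scale_right_distrib vector_smult_assoc add.commute)
    moreover have "x0 + (s / t) *s h0 \<noteq> 0" using nk[of "- (s/t)"]
      by (metis add_eq_0_iff2 vec.scale_minus_left)
    moreover have "z1 \<noteq> 0" using z1 by auto
    ultimately have "vec.span {x0 + (s / t) *s h0} = z"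
      using span_sing_eq_iff z1(3) by blast
    then show "z \<in> L" by (auto simp: L_def)
  qed
  have oh: "orth (vec.span {h0}) z \<longleftrightarrow> b h0 z1 = 0" unfolding z1(3) by (rule orth_span)
  show ?thesis
  proof (cases "b h0 z1 = 0")
    case True
    then have "?T = (if b x0 z1 = 0 then UNIV else {})" by auto
    then show ?thesis using True zL oh card_T by auto
  next
    case False
    then have "?T = {- b x0 z1 / b h0 z1}" by (auto simp: field_simps add_eq_0_iff)
    then show ?thesis using False zL oh card_T by auto
  qed
qed

text \<open>The neighbour \<open>z0\<close> supplies a line of the quadric through \<open>h\<close>.
  Summing neighbours over its points outside \<open>hyp\<close> gives
  \<open>4q + q * card (L \<inter> Z)\<close>; counting from the side of \<open>Z\<close> and
  including \<open>h\<close> gives \<open>4(q + 1) + q * card (L \<inter> Z)\<close>. The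
  difference, 4, is the contribution of \<open>h\<close>.\<close>

lemma card_nbr_hyp:
  assumes h: "h \<in> quadric_in f hyp" and z0: "z0 \<in> nbr h"
  shows "card (nbr h) = 4"
proof -
  obtain h0 where h0: "h0 \<in> hyp" "h0 \<noteq> 0" "f h0 = 0" "h = vec.span {h0}"
    using h in_quadric_in_iff[OF subspace_hyp] by blast
  have "z0 \<in> quadric_minus f hyp" using z0 Z_minus by (auto simp: nbr_def)
  then obtain x0 where x0: "b c x0 \<noteq> 0" "f x0 = 0" "z0 = vec.span {x0}"
    by (auto simp: in_quadric_minus_iff)
  have hx: "b h0 x0 = 0" using z0 unfolding nbr_def h0(4) x0(3) mem_Collect_eq orth_span by simp
  define L where "L = range (\<lambda>t. vec.span {x0 + t *s h0})"
  note line = card_line_minus_orth[OF h0(1-3) x0(1,2) hx, folded L_def h0(4)]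
  have L_minus: "p \<in> quadric_minus f hyp" if pL: "p \<in> L" for p
  proof -
    obtain t where t: "p = vec.span {x0 + t *s h0}" using pL by (auto simp: L_def)
    have "b c (x0 + t *s h0) \<noteq> 0" "f (x0 + t *s h0) = 0"
      using h0 x0 hx by (auto simp: b_simps f_simps hyp_def b_commute)
    then show ?thesis using t in_quadric_minus_iff by blast
  qed
  have finL: "finite L" by (simp add: L_def)
  \<comment> \<open>All points of \<open>L\<close> are orthogonal to \<open>z0\<close>, so applying
    \<open>line\<close> to \<open>z0\<close> already yields the size of \<open>L\<close>.\<close>
  have cardL: "card L = CARD('a)"
  proof -
    have z0L: "z0 \<in> L" unfolding L_def x0(3) by (rule range_eqI[of _ _ 0]) simp
    have "orth h z0" using z0 by (simp add: nbr_def)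
    then have "card {p \<in> L. orth p z0} = CARD('a)"
      using line[of z0] z0L L_minus[OF z0L] by simp
    moreover have "card {p \<in> L. orth p z0} \<le> card L" by (rule card_mono) (auto simp: finL)
    moreover have "card L \<le> CARD('a)" unfolding L_def by (rule card_image_le) simp
    ultimately show ?thesis by simp
  qed
  have "(\<Sum>p\<in>L. card {z \<in> Z. orth p z}) = (\<Sum>p\<in>L. 4 + (if p \<in> Z then CARD('a) else 0))"
    by (rule sum.cong) (auto simp: card_orth_minus L_minus)
  also have "\<dots> = 4 * CARD('a) + CARD('a) * card (L \<inter> Z)"
    using finL cardL by (simp add: sum.distrib sum.inter_restrict[symmetric])
  finally have 1: "(\<Sum>p\<in>L. card {z \<in> Z. orth p z}) = 4 * CARD('a) + CARD('a) * card (L \<inter> Z)" .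
  have "(\<Sum>p\<in>L. card {z \<in> Z. orth p z}) = (\<Sum>z\<in>Z. card {p \<in> L. orth p z})"
    using finL finite_Z by (rule sum_card_swap)
  moreover have "card (nbr h) = (\<Sum>z\<in>Z. of_bool (orth h z))"
    by (simp add: nbr_def Int_def)
  ultimately have "(\<Sum>p\<in>L. card {z \<in> Z. orth p z}) + card (nbr h)
      = (\<Sum>z\<in>Z. card {p \<in> L. orth p z} + of_bool (orth h z))"
    by (simp add: sum.distrib)
  also have "\<dots> = (\<Sum>z\<in>Z. 1 + (if z \<in> L then CARD('a) else 0))"
    by (rule sum.cong) (use line Z_minus in auto)
  also have "\<dots> = card Z + CARD('a) * card (L \<inter> Z)"
    unfolding sum.distrib by (simp add: sum.inter_restrict[symmetric] Int_commute)
  finally show ?thesis using 1 card_Z by simp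
qed

text \<open>A point of the quadric outside \<open>Z\<close> has at most 4 neighbours in
  \<open>Z\<close>, whether it lies in \<open>hyp\<close> or not.\<close>

lemma nbr_ge_5_in_Z:
  assumes p: "p \<in> quadric f" and A: "A \<subseteq> Z" "\<And>r. r \<in> A \<Longrightarrow> orth p r" "card A \<ge> 5"
  shows "p \<in> Z"
proof (rule ccontr)
  assume "p \<notin> Z"
  have "A \<subseteq> nbr p" using A by (auto simp: nbr_def)
  then have c: "card (nbr p) \<ge> 5" using A card_mono[OF finite_nbr] by (meson le_trans)
  then obtain z0 where z0: "z0 \<in> nbr p" by (metis card.empty ex_in_conv not_numeral_le_zero)
  show False
  proof (cases "p \<subseteq> hyp")
    case True
    then show False using card_nbr_hyp[OF _ z0] p c by (simp add: quadric_in_def)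
  next
    case False
    then have "p \<in> quadric_minus f hyp" using p by (simp add: quadric_minus_def quadric_in_def)
    then show False using card_orth_minus \<open>p \<notin> Z\<close> c by (simp add: nbr_def)
  qed
qed

text \<open>Otherwise \<open>x\<close>, \<open>u\<close>, \<open>v\<close> lie on one line of the
  quadric. Its point \<open>h\<close> in \<open>hyp\<close> is orthogonal to these three points of
  \<open>Z\<close> and to their images under \<open>sig\<close>, six in all, but \<open>h\<close>
  has only 4 neighbours.\<close>

lemma nbr_not_orth:
  assumes "x \<in> Z" "u \<in> nbr x" "v \<in> nbr x" "u \<noteq> x" "v \<noteq> x" "u \<noteq> v"
  shows "\<not> orth u v"
proof
  assume uv: "orth u v"
  have Z: "u \<in> Z" "v \<in> Z" "orth x u" "orth x v" using assms by (auto simp: nbr_def)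
  obtain x0 where x0: "b c x0 \<noteq> 0" "f x0 = 0" "x = vec.span {x0}"
    using Z_minus[OF assms(1)] by (auto simp: in_quadric_minus_iff)
  obtain u0 where u0: "b c u0 \<noteq> 0" "f u0 = 0" "u = vec.span {u0}"
    using Z_minus[OF Z(1)] by (auto simp: in_quadric_minus_iff)
  obtain v0 where v0: "b c v0 \<noteq> 0" "f v0 = 0" "v = vec.span {v0}"
    using Z_minus[OF Z(2)] by (auto simp: in_quadric_minus_iff)
  have orth0: "b x0 u0 = 0" "b x0 v0 = 0" "b u0 v0 = 0"
    using Z uv unfolding x0 u0 v0 orth_span by auto
  have nk: "u0 \<noteq> k *s x0" for k
  proof
    assume "u0 = k *s x0"
    moreover have "x0 \<noteq> 0" "u0 \<noteq> 0" using x0 u0 by auto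
    ultimately have "vec.span {x0} = vec.span {u0}" using span_sing_eq_iff by blast
    then show False using assms x0 u0 by simp
  qed
  have "v0 \<in> vec.span {x0, u0}"
    by (rule totally_singular_span3) (use x0 u0 v0 orth0 nk in auto)
  then obtain s t where v0_eq: "v0 = s *s x0 + t *s u0" by (auto simp: in_span2)
  define h0 where "h0 = u0 - (b c u0 / b c x0) *s x0"
  have h0: "h0 \<in> hyp" "h0 \<noteq> 0" "f h0 = 0"
    using x0 u0 orth0 nk[of "b c u0 / b c x0"]
    by (auto simp: h0_def hyp_def b_simps f_simps b_commute)
  define h where "h = vec.span {h0}"
  have h: "h \<in> quadric_in f hyp" using h0 in_quadric_in_iff[OF subspace_hyp] h_def by blast
  have hx: "orth h x" unfolding h_def x0(3) orth_span h0_def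
    using x0 orth0 by (simp add: b_simps b_self b_commute)
  have hu: "orth h u" unfolding h_def u0(3) orth_span h0_def
    using u0 orth0 by (simp add: b_simps b_self b_commute)
  have hv: "orth h v" unfolding h_def v0(3) orth_span h0_def
    using orth0 by (simp add: b_simps b_commute)
  have sub: "{x, u, v} \<union> sig ` {x, u, v} \<subseteq> nbr h"
    using hx hu hv assms(1) Z(1,2) by (simp add: nbr_def sig_Z orth_hyp_sig[OF h] Z_quadric)
  \<comment> \<open>The three points are mutually orthogonal, while no image \<open>sig y\<close> is
    orthogonal to \<open>y\<close>.\<close>
  have "sig y \<notin> {x, u, v}" if "y \<in> {x, u, v}" for y
  proof -
    have o: "orth r r'" if "r \<in> {x, u, v}" "r' \<in> {x, u, v}" for r r'
    proof -
      have q: "x \<in> quadric f" "u \<in> quadric f" "v \<in> quadric f"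
        using assms(1) Z(1,2) Z_quadric by auto
      have "orth u x" "orth v x" "orth v u"
        using Z(3,4) uv orth_commute[OF q(1,2)] orth_commute[OF q(1,3)] orth_commute[OF q(2,3)] by simp_all
      then show ?thesis using that Z(3,4) uv q orth_refl by (elim insertE emptyE) simp_all
    qed
    have y: "y \<in> quadric_minus f hyp" using that Z_minus Z assms(1) by auto
    show ?thesis using o[OF that, of "sig y"] not_orth_sig'[OF y y o[OF that that]] by metis
  qed
  then have dis: "{x, u, v} \<inter> sig ` {x, u, v} = {}" by blast
  have inj: "inj sig" by (metis injI sig_sig)
  have "card (sig ` {x, u, v}) = card {x, u, v}"
    by (rule card_image[OF inj_on_subset[OF inj subset_UNIV]])
  moreover have "card {x, u, v} = 3" using assms by auto
  ultimately have "card ({x, u, v} \<union> sig ` {x, u, v}) = 6"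
    using dis by (subst card_Un_disjoint) auto
  moreover have "card ({x, u, v} \<union> sig ` {x, u, v}) \<le> card (nbr h)" using sub by (intro card_mono) auto
  ultimately show False using card_nbr_hyp[OF h, of x] sub by auto
qed

lemma exists_triad:
  "\<exists>u\<in>Z. \<exists>v\<in>Z. \<exists>w\<in>Z. \<not> orth u v \<and> \<not> orth u w \<and> \<not> orth v w \<and>
     5 \<le> card {x \<in> Z. orth x u \<and> orth x v \<and> orth x w}"
proof (rule ccontr)
  assume neg: "\<not> ?thesis"
  obtain u where u: "u \<in> Z" using card_Z by (metis card.empty ex_in_conv add_eq_0_iff_both_eq_0 mult_eq_0_iff one_neq_zero zero_neq_numeral)
  let ?q = "CARD('a)"
  define N where "N = nbr u - {u}"
  define M where "M = Z - nbr u"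
  have uu: "u \<in> nbr u" using u orth_refl Z_quadric by (simp add: nbr_def)
  have cN: "card N = ?q + 3" using uu card_nbr_Z[OF u] by (simp add: N_def)
  have cM: "card M = 3 * ?q"
    using card_nbr_Z[OF u] card_Z by (simp add: M_def card_Diff_subset nbr_def)
  have NZ: "x \<in> Z" "orth x u" "x \<noteq> u" if "x \<in> N" for x
    using that u orth_commute Z_quadric by (auto simp: N_def nbr_def)
  have P: "card {v \<in> M. orth x v} = ?q + 2" if x: "x \<in> N" for x
  proof -
    have ux: "u \<in> nbr x" using NZ[OF x] u by (simp add: nbr_def)
    have xx: "x \<in> nbr x" using NZ[OF x] orth_refl Z_quadric by (simp add: nbr_def)
    \<comment> \<open>Among the \<open>q + 4\<close> neighbours of \<open>x\<close> only
      \<open>x\<close> and \<open>u\<close> are orthogonal to \<open>u\<close>, by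
      \<open>nbr_not_orth\<close>; the remaining \<open>q + 2\<close> lie in
      \<open>M\<close>.\<close>
    have "{v \<in> M. orth x v} = nbr x - {x, u}"
      using nbr_not_orth[OF NZ(1)[OF x] ux] NZ[OF x] uu x
      by (auto simp: M_def N_def nbr_def)
    then show ?thesis using ux xx NZ[OF x] card_nbr_Z[OF NZ(1)[OF x]] by (simp add: card_Diff_subset)
  qed
  have "(?q + 3) * ((?q + 2) * (?q + 2)) = (\<Sum>x\<in>N. card ({v \<in> M. orth x v} \<times> {w \<in> M. orth x w}))"
    using P cN by (simp add: card_cartesian_product)
  also have "\<dots> = (\<Sum>x\<in>N. card {p \<in> M \<times> M. orth x (fst p) \<and> orth x (snd p)})"
    by (intro sum.cong refl arg_cong[of _ _ card]) auto
  also have "\<dots> = (\<Sum>p\<in>M \<times> M. card {x \<in> N. orth x (fst p) \<and> orth x (snd p)})"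
    by (rule sum_card_swap) auto
  \<comment> \<open>A pair of equal points has at most \<open>card N = q + 3\<close> common
    neighbours in \<open>N\<close>, a pair of distinct orthogonal points has none, and any other
    pair has at most 4 by the assumption for contradiction.\<close>
  also have "\<dots> \<le> (\<Sum>p\<in>M \<times> M. 4 + (if fst p = snd p then ?q + 3 else 0))"
  proof (rule sum_mono)
    fix p assume "p \<in> M \<times> M"
    then obtain v w where p: "p = (v, w)" "v \<in> M" "w \<in> M" by auto
    have vw: "v \<in> Z" "w \<in> Z" "\<not> orth u v" "\<not> orth u w"
      using p by (auto simp: M_def nbr_def)
    let ?A = "{x \<in> N. orth x v \<and> orth x w}"
    have "card ?A \<le> 4 + (if v = w then ?q + 3 else 0)"
    proof (cases "v = w")
      case True
      have "card ?A \<le> card N" by (rule card_mono) auto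
      then show ?thesis using cN True by simp
    next
      case False
      show ?thesis
      proof (cases "orth v w")
        case True
        have "?A = {}"
        proof (rule ccontr)
          assume "?A \<noteq> {}"
          then obtain x where x: "x \<in> N" "orth x v" "orth x w" by auto
          then have "v \<noteq> x" "w \<noteq> x"
            using p by (auto simp: N_def M_def)
          then show False using nbr_not_orth[OF NZ(1)[OF x(1)], of v w] x vw False True
            by (auto simp: nbr_def)
        qed
        then show ?thesis by (simp only: card.empty)
      next
        case no: False
        then have "card {x \<in> Z. orth x u \<and> orth x v \<and> orth x w} < 5" using neg u vw by force
        moreover have "card ?A \<le> card {x \<in> Z. orth x u \<and> orth x v \<and> orth x w}"
          using NZ by (intro card_mono) auto
        ultimately show ?thesis by simp
      qed
    qed
    then show "card {x \<in> N. orth x (fst p) \<and> orth x (snd p)} \<le> 4 + (if fst p = snd p then ?q + 3 else 0)"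
      by (simp add: p)
  qed
  also have "\<dots> = (\<Sum>v\<in>M. \<Sum>w\<in>M. 4 + (if v = w then ?q + 3 else 0))"
    by (simp add: sum.cartesian_product case_prod_unfold)
  also have "\<dots> = 3 * ?q * (4 * (3 * ?q) + (?q + 3))"
    using cM by (simp add: sum.distrib)
  \<comment> \<open>The left side grows like \<open>q^3\<close>, the right side like
    \<open>39 * q^2\<close>; the bound on \<open>q\<close> makes this impossible.\<close>
  finally have "(?q + 3) * ((?q + 2) * (?q + 2)) \<le> 3 * ?q * (4 * (3 * ?q) + (?q + 3))" .
  moreover have "59 * (?q * ?q) \<le> ?q * (?q * ?q)" using field_card by (intro mult_right_mono) auto
  ultimately show False using field_card by (simp add: algebra_simps)
qed

end

section \<open>Two conics of \<open>Z\<close> in mutually polar planes\<close>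

locale conic_pair = balanced_set +
  fixes u v w u' v' w' :: "'a ^ 6" and W W' :: "('a ^ 6) set"
  assumes W_eq: "W = vec.span {u, v, w}" and W'_eq: "W' = vec.span {u', v', w'}"
    and T: "triad u v w" and T': "triad u' v' w'"
    and perp_W: "perp f W = W'"
    and conic_Z: "quadric_in f W \<subseteq> Z" and conic_Z': "quadric_in f W' \<subseteq> Z"
begin

lemma subspace_W: "vec.subspace W" and subspace_W': "vec.subspace W'"
  by (auto simp: W_eq W'_eq)

lemma perp_W': "perp f W' = W"
  using perp_perp[OF subspace_W] perp_W by simp

lemma in_W: "u \<in> W" "v \<in> W" "w \<in> W"
  by (auto simp: W_eq vec.span_base)

text \<open>The situation is symmetric in the two planes, so facts proved for one of them transfer
  to the other.\<close>

lemma swap: "conic_pair f c Z u' v' w' u v w W' W"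
  using T T' perp_W' conic_Z conic_Z'
  by unfold_locales (auto simp: W_eq W'_eq)

lemma W_orth: "x \<in> W \<Longrightarrow> y \<in> W' \<Longrightarrow> b x y = 0"
  using perp_W by (auto simp: perp_def)

lemma orth_conics: "p \<in> quadric_in f W \<Longrightarrow> r \<in> quadric_in f W' \<Longrightarrow> orth p r"
  using W_orth by (auto simp: orth_def perp_def quadric_in_def)

lemma W_external: "x \<in> W \<Longrightarrow> f x = 0 \<Longrightarrow> b c x = 0 \<Longrightarrow> x = 0"
proof (rule ccontr)
  assume x: "x \<in> W" "f x = 0" "b c x = 0" "x \<noteq> 0"
  then have "vec.span {x} \<in> quadric_in f W" using in_quadric_in_iff[OF subspace_W] by blast
  then have "vec.span {x} \<in> quadric_minus f hyp" using conic_Z Z_subset by blast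
  then have "\<not> vec.span {x} \<subseteq> hyp" by (simp add: quadric_minus_def quadric_in_def)
  then show False using x by (simp add: span_subset_iff[OF subspace_hyp]) (simp add: hyp_def)
qed

lemma c_notin_W': "c \<notin> W'"
proof
  assume "c \<in> W'"
  then have "b c u = 0" using W_orth[OF in_W(1)] b_commute by metis
  then show False using W_external[OF in_W(1)] triadD[OF T] by auto
qed

lemma conics_disjoint: "quadric_in f W \<inter> quadric_in f W' = {}"
proof (rule ccontr)
  assume "quadric_in f W \<inter> quadric_in f W' \<noteq> {}"
  then obtain p where p: "p \<in> quadric_in f W" "p \<in> quadric_in f W'" by blast
  obtain x where x: "x \<in> W" "x \<noteq> 0" "f x = 0" "p = vec.span {x}"
    using p in_quadric_in_iff[OF subspace_W] by blast
  have "p \<subseteq> W'" using p by (simp add: quadric_in_def)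
  then have "x \<in> W'" using x subspace_W' by (simp add: span_subset_iff)
  then show False using triad_nonsingular[OF T, of x] x W_orth in_W unfolding W_eq by blast
qed

text \<open>If the plane contained a point together with its image, it would contain the difference
  of the representatives, a nonzero multiple of \<open>c\<close>.\<close>

lemma conic_sig_disjoint': "quadric_in f W' \<inter> sig ` quadric_in f W' = {}"
proof (rule ccontr)
  assume "quadric_in f W' \<inter> sig ` quadric_in f W' \<noteq> {}"
  then obtain r where r: "r \<in> quadric_in f W'" "sig r \<in> quadric_in f W'" by blast
  obtain x where x: "x \<in> W'" "x \<noteq> 0" "f x = 0" "r = vec.span {x}"
    using r in_quadric_in_iff[OF subspace_W'] by blast
  have "sig r \<subseteq> W'" using r by (simp add: quadric_in_def)
  then have "reflect x \<in> W'" using x subspace_W' by (simp add: span_subset_iff sig_span)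
  then have "x - reflect x \<in> W'" using x subspace_W' by (simp add: vec.subspace_diff)
  then have c: "(b c x / f c) *s c \<in> W'" by (simp add: reflect_def)
  interpret swap: conic_pair f c Z u' v' w' u v w W' W by (rule swap)
  have "b c x \<noteq> 0" using swap.W_external[of x] x by auto
  then have "c = (f c / b c x) *s ((b c x / f c) *s c)"
    using c_nonsingular by (simp add: vector_smult_assoc)
  then have "c \<in> W'" using c subspace_W' by (metis vec.subspace_scale)
  then show False using c_notin_W' by simp
qed

text \<open>A common point would be the image of a point of the other conic and orthogonal to it,
  which is impossible outside \<open>hyp\<close>.\<close>

lemma conic_sig_conic_disjoint: "quadric_in f W \<inter> sig ` quadric_in f W' = {}"
proof (rule ccontr)
  assume "quadric_in f W \<inter> sig ` quadric_in f W' \<noteq> {}"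
  then obtain r where r: "r \<in> quadric_in f W'" "sig r \<in> quadric_in f W" by blast
  have X: "r \<in> quadric_minus f hyp" using r conic_Z' Z_subset by blast
  have "orth (sig r) r" using orth_conics r by blast
  then have "orth r (sig r)"
    using orth_commute quadric_minusD[OF X] quadric_minusD[OF sig_quadric_minus[OF X]] by blast
  then show False using not_orth_sig'[OF X X orth_refl[OF quadric_minusD[OF X]]] by blast
qed

interpretation swap: conic_pair f c Z u' v' w' u v w W' W
  by (rule swap)

text \<open>The four conics are pairwise disjoint subsets of \<open>Z\<close> with at least
  \<open>q + 1\<close> points each, and \<open>Z\<close> has exactly \<open>4(q + 1)\<close>
  points.\<close>

lemma Z_eq: "Z = quadric_in f W \<union> quadric_in f W' \<union> sig ` quadric_in f W \<union> sig ` quadric_in f W'"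
  and card_conic: "card (quadric_in f W') = CARD('a) + 1"
proof -
  let ?C = "quadric_in f W" and ?C' = "quadric_in f W'"
  let ?U = "?C \<union> ?C' \<union> sig ` ?C \<union> sig ` ?C'"
  have sub: "?U \<subseteq> Z" using conic_Z conic_Z' sig_Z by blast
  have d1: "?C \<inter> ?C' = {}" by (rule conics_disjoint)
  then have d2: "sig ` ?C \<inter> sig ` ?C' = {}" using inj_sig by (metis image_Int image_empty)
  have d3: "(?C \<union> ?C') \<inter> (sig ` ?C \<union> sig ` ?C') = {}"
    by (simp only: Int_Un_distrib Int_Un_distrib2 conic_sig_disjoint' conic_sig_conic_disjoint
        swap.conic_sig_disjoint' swap.conic_sig_conic_disjoint Un_empty_left)
  have "card ?U = card (?C \<union> ?C') + card (sig ` ?C \<union> sig ` ?C')"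
    using d3 by (metis Un_assoc card_Un_disjoint finite)
  also have "\<dots> = 2 * card ?C + 2 * card ?C'"
    using d1 d2 by (simp add: card_Un_disjoint card_sig)
  finally have cU: "card ?U = 2 * card ?C + 2 * card ?C'" .
  have ge: "CARD('a) + 1 \<le> card ?C" "CARD('a) + 1 \<le> card ?C'"
    unfolding W_eq W'_eq using triad_conic_card T T' by blast+
  have "card ?U \<le> card Z" by (rule card_mono[OF finite_Z sub])
  then have le: "2 * card ?C + 2 * card ?C' \<le> 4 * (CARD('a) + 1)" by (simp only: cU card_Z)
  have eq: "card ?C' = CARD('a) + 1" "card ?C = CARD('a) + 1"
    by (rule antisym, use le ge in simp, rule ge)+
  then have "card ?U = card Z" by (simp only: cU card_Z)
  then show "Z = ?U" using card_subset_eq[OF finite_Z sub] by simp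
  show "card ?C' = CARD('a) + 1" by (rule eq(1))
qed

text \<open>The point of \<open>u\<close> has \<open>q + 4\<close> neighbours in \<open>Z\<close>.
  Its own conic contributes only the point itself, the polar conic all its \<open>q + 1\<close>
  points, and the image of the polar conic none. The missing two lie on the image of its own
  conic.\<close>

lemma collinear_reflected:
  obtains y where "y \<in> W" "f y = 0" "b u (reflect y) = 0" "\<And>k. reflect y \<noteq> k *s u" "y \<noteq> 0"
proof -
  note T'' = triadD[OF T]
  let ?p = "vec.span {u}"
  have u0: "u \<noteq> 0" using T'' by auto
  have p: "?p \<in> quadric_in f W" using in_W u0 T'' in_quadric_in_iff[OF subspace_W] by blast
  then have pZ: "?p \<in> Z" using conic_Z by blast
  have "nbr ?p \<subseteq> {?p} \<union> quadric_in f W' \<union> (nbr ?p \<inter> sig ` quadric_in f W)"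
  proof
    fix r assume r: "r \<in> nbr ?p"
    then have rZ: "r \<in> Z" "orth ?p r" by (auto simp: nbr_def)
    then consider "r \<in> quadric_in f W" | "r \<in> quadric_in f W'" | "r \<in> sig ` quadric_in f W"
      | "r \<in> sig ` quadric_in f W'" using Z_eq by blast
    then show "r \<in> {?p} \<union> quadric_in f W' \<union> (nbr ?p \<inter> sig ` quadric_in f W)"
    proof cases
      case 1
      then obtain x where x: "x \<in> W" "x \<noteq> 0" "f x = 0" "r = vec.span {x}"
        using in_quadric_in_iff[OF subspace_W] by blast
      then have "b u x = 0" using rZ orth_span by simp
      then obtain k where "x = k *s u" using triad_tangent[OF T] x W_eq by blast
      then have "r = ?p" using x u0 span_sing_eq_iff by metis
      then show ?thesis by simp
    next
      case 4
      then obtain r' where r': "r' \<in> quadric_in f W'" "r = sig r'" by blast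
      have "orth ?p r'" using orth_conics p r' by blast
      then have "\<not> orth ?p (sig r')"
        using not_orth_sig' Z_minus pZ r' conic_Z' by blast
      then show ?thesis using rZ r' by simp
    qed (use r in auto)
  qed
  then have "card (nbr ?p) \<le> card ({?p} \<union> quadric_in f W' \<union> (nbr ?p \<inter> sig ` quadric_in f W))"
    by (rule card_mono[rotated]) simp
  also have "\<dots> \<le> 1 + (CARD('a) + 1) + card (nbr ?p \<inter> sig ` quadric_in f W)"
    using card_Un_le[of "{?p}" "quadric_in f W'"] card_conic
      card_Un_le[of "{?p} \<union> quadric_in f W'" "nbr ?p \<inter> sig ` quadric_in f W"] by simp
  finally have "card (nbr ?p \<inter> sig ` quadric_in f W) \<noteq> 0" using card_nbr_Z[OF pZ] by linarith
  then obtain r where r: "r \<in> quadric_in f W" "orth ?p (sig r)"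
    by (auto simp: nbr_def)
  obtain y where y: "y \<in> W" "y \<noteq> 0" "f y = 0" "r = vec.span {y}"
    using r in_quadric_in_iff[OF subspace_W] by blast
  have "b u (reflect y) = 0" using r(2) unfolding y(4) sig_span orth_span .
  moreover have "reflect y \<noteq> k *s u" for k
  proof
    assume ry: "reflect y = k *s u"
    have "reflect y \<noteq> 0" using y by simp
    then have "?p = sig r" using ry u0 y span_sing_eq_iff[OF u0, of "reflect y"] by (simp add: sig_span)
    then show False using p r swap.conic_sig_disjoint' by blast
  qed
  ultimately show ?thesis using that y by blast
qed

text \<open>This provides the data for \<open>totally_singular_graph\<close>: \<open>z = u\<close>
  and \<open>z' = reflect y\<close> span a totally singular line. The first summands of both lie in
  \<open>W \<inter> hyp\<close>, and \<open>g = e\<close>, \<open>g' = k *s reflect e\<close> are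
  orthogonal to both lines cut out by \<open>hyp\<close>.\<close>

lemma conic_plane_graph_decomposition:
  obtains a e z z' d d' g g' where "external_line (W \<inter> hyp)" "u = a + e" "a \<in> W \<inter> hyp" "a \<noteq> 0"
    "e \<in> W" "b c e \<noteq> 0" "\<And>x. x \<in> W \<inter> hyp \<Longrightarrow> b e x = 0"
    "\<And>x. x \<in> W \<Longrightarrow> \<exists>k. x - k *s e \<in> W \<inter> hyp"
    "z = d + g" "z' = d' + g'" "d \<in> W \<inter> hyp" "d' \<in> W \<inter> hyp"
    "\<And>x. x \<in> (W \<union> W') \<inter> hyp \<Longrightarrow> b g x = 0" "\<And>x. x \<in> (W \<union> W') \<inter> hyp \<Longrightarrow> b g' x = 0"
    "f z = 0" "f z' = 0" "b z z' = 0" "z \<noteq> 0" "\<And>k. z' \<noteq> k *s z"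
proof -
  obtain a e where ae: "external_line (W \<inter> hyp)" "u = a + e" "a \<in> W \<inter> hyp" "a \<noteq> 0"
    "e \<in> W" "b c e \<noteq> 0" "\<And>x. x \<in> W \<inter> hyp \<Longrightarrow> b e x = 0"
    "\<And>x. x \<in> W \<Longrightarrow> \<exists>k. x - k *s e \<in> W \<inter> hyp"
    using conic_plane_decomposition[OF T, of W] W_external W_eq by metis
  obtain y where y: "y \<in> W" "f y = 0" "b u (reflect y) = 0" "\<And>k. reflect y \<noteq> k *s u" "y \<noteq> 0"
    using collinear_reflected by metis
  obtain k where k: "y - k *s e \<in> W \<inter> hyp" using ae(8) y(1) by blast
  have e_orth: "b e x = 0" if "x \<in> (W \<union> W') \<inter> hyp" for x
    using that ae(7) W_orth[OF ae(5)] by blast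
  have re_orth: "b (reflect e) x = 0" if "x \<in> (W \<union> W') \<inter> hyp" for x
    using that e_orth b_reflect[of e x] reflect_hyp[of x] by auto
  have ry: "reflect y = (y - k *s e) + k *s reflect e"
    using reflect_hyp[of "y - k *s e"] k reflect_add[of "y - k *s e" "k *s e"] by (simp add: reflect_scale)
  have kre_orth: "b (k *s reflect e) x = 0" if "x \<in> (W \<union> W') \<inter> hyp" for x
    using re_orth[OF that] by (simp add: b_simps)
  show ?thesis
  proof (rule that[OF ae ae(2) ry ae(3) k e_orth kre_orth])
    show "f u = 0" using triadD[OF T] by simp
    then show "u \<noteq> 0" using triadD[OF T] by auto
    show "f (reflect y) = 0" using y by simp
  qed (assumption | rule y(3,4))+
qed

end

context conic_pair
begin

lemma conic_union:
  assumes coll: "central_collineation \<sigma> hyp (vec.span {c})"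
    and \<sigma>_X: "\<And>p. p \<in> quadric_minus f hyp \<Longrightarrow> \<sigma> p = sig p"
  shows "\<exists>S l1 l2 p1 p2.
      proj_solid S \<and> S \<subseteq> hyp \<and> hyperbolic_on f S \<and>
      proj_line (perp f S) \<and> quadric_in f (perp f S) = {} \<and> perp f hyp \<subseteq> perp f S \<and>
      proj_line l1 \<and> l1 \<subseteq> S \<and> quadric_in f l1 = {} \<and>
      proj_point p1 \<and> p1 \<subseteq> perp f S \<and> p1 \<noteq> perp f hyp \<and>
      proj_point p2 \<and> p2 \<subseteq> perp f S \<and> p2 \<noteq> perp f hyp \<and>
      p2 \<subseteq> perp f p1 \<and>
      l2 = perp f l1 \<inter> S \<and>
      conic_plane f (proj_join p1 l1) \<and> conic_plane f (proj_join p2 l2) \<and>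
      conic_plane f (proj_join (\<sigma> p1) l1) \<and> conic_plane f (proj_join (\<sigma> p2) l2) \<and>
      Z = quadric_in f (proj_join p1 l1) \<union> quadric_in f (proj_join p2 l2) \<union>
          quadric_in f (proj_join (\<sigma> p1) l1) \<union> quadric_in f (proj_join (\<sigma> p2) l2)"
proof -
  interpret sw: conic_pair f c Z u' v' w' u v w W' W by (rule swap)
  define l1 l2 where "l1 = W \<inter> hyp" and "l2 = W' \<inter> hyp"
  obtain a1 e1 z1 z1' d1 d1' g1 g1' where h1: "external_line (W \<inter> hyp)" "u = a1 + e1"
    "a1 \<in> W \<inter> hyp" "a1 \<noteq> 0"
    "e1 \<in> W" "b c e1 \<noteq> 0" "\<And>x. x \<in> W \<inter> hyp \<Longrightarrow> b e1 x = 0"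
    "\<And>x. x \<in> W \<Longrightarrow> \<exists>k. x - k *s e1 \<in> W \<inter> hyp"
    "z1 = d1 + g1" "z1' = d1' + g1'" "d1 \<in> W \<inter> hyp" "d1' \<in> W \<inter> hyp"
    "\<And>x. x \<in> (W \<union> W') \<inter> hyp \<Longrightarrow> b g1 x = 0" "\<And>x. x \<in> (W \<union> W') \<inter> hyp \<Longrightarrow> b g1' x = 0"
    "f z1 = 0" "f z1' = 0" "b z1 z1' = 0" "z1 \<noteq> 0" "\<And>k. z1' \<noteq> k *s z1"
    by (rule conic_plane_graph_decomposition) (rule that, assumption+)
  obtain a2 e2 z2 z2' d2 d2' g2 g2' where h2: "external_line (W' \<inter> hyp)" "u' = a2 + e2"
    "a2 \<in> W' \<inter> hyp" "a2 \<noteq> 0"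
    "e2 \<in> W'" "b c e2 \<noteq> 0" "\<And>x. x \<in> W' \<inter> hyp \<Longrightarrow> b e2 x = 0"
    "\<And>x. x \<in> W' \<Longrightarrow> \<exists>k. x - k *s e2 \<in> W' \<inter> hyp"
    "z2 = d2 + g2" "z2' = d2' + g2'" "d2 \<in> W' \<inter> hyp" "d2' \<in> W' \<inter> hyp"
    "\<And>x. x \<in> (W' \<union> W) \<inter> hyp \<Longrightarrow> b g2 x = 0" "\<And>x. x \<in> (W' \<union> W) \<inter> hyp \<Longrightarrow> b g2' x = 0"
    "f z2 = 0" "f z2' = 0" "b z2 z2' = 0" "z2 \<noteq> 0" "\<And>k. z2' \<noteq> k *s z2"
    by (rule sw.conic_plane_graph_decomposition) (rule that, assumption+)
  interpret orthogonal_external_lines f l1 l2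
    by unfold_locales (use h1(1) h2(1) W_orth in \<open>auto simp: l1_def l2_def\<close>)
  have l_hyp: "l1 \<subseteq> hyp" "l2 \<subseteq> hyp" by (auto simp: l1_def l2_def)
  have l12_Un: "l1 \<union> l2 = (W \<union> W') \<inter> hyp" by (auto simp: l1_def l2_def)
  have in_m: "x \<in> m" if "\<And>y. y \<in> (W \<union> W') \<inter> hyp \<Longrightarrow> b x y = 0" for x
    unfolding S_def in_perp_span_iff l12_Un using that by (metis b_commute)
  have e_m: "e1 \<in> m" "e2 \<in> m"
    by (rule in_m, use h1(5,7) h2(5,7) W_orth sw.W_orth in blast)+
  have c_m: "c \<in> m" by (rule in_m) (simp add: hyp_def)
  have g_m: "g1 \<in> m" "g1' \<in> m" "g2 \<in> m" "g2' \<in> m"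
    by (rule in_m, use h1(13,14) h2(13,14) in blast)+
  have d: "d1 \<in> l1" "d1' \<in> l1" "d2 \<in> l2" "d2' \<in> l2"
    using h1(11,12) h2(11,12) by (auto simp: l1_def l2_def)
  note graph1 = totally_singular_graph[OF l1 l1_S h1(9,10) d(1,2) g_m(1,2) h1(15-19)]
  note graph2 = totally_singular_graph[OF l2 l2_S h2(9,10) d(3,4) g_m(3,4) h2(15-19)]
  have ts: "totally_singular f (vec.span {z1, z1'})" "totally_singular f (vec.span {z2, z2'})"
    using h1(15-17) h2(15-17)
    by (auto simp: totally_singular_def in_span2 f_simps b_simps)
  have ext_m: "external_line m" by (rule graph1(1))
  have hyp_S: "hyperbolic_on f S" by (rule hyperbolic_S[OF ext_m ts(1) graph1(2) ts(2) graph2(2)])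
  have no_pts: "quadric_in f l = {}" if "external_line l" for l
    using in_quadric_in_iff[OF external_line_subspace[OF that]] external_line_0[OF that] by blast
  define p1 p2 where "p1 = vec.span {e1}" and "p2 = vec.span {e2}"
  have e0: "e1 \<noteq> 0" "e2 \<noteq> 0" using h1(6) h2(6) by auto
  have join: "proj_join (vec.span {e}) (V \<inter> hyp) = V"
    if V: "vec.subspace V" and e: "e \<in> V" "\<And>x. x \<in> V \<Longrightarrow> \<exists>k. x - k *s e \<in> V \<inter> hyp" for V e
  proof (intro equalityI subsetI)
    fix x assume "x \<in> proj_join (vec.span {e}) (V \<inter> hyp)"
    moreover have "proj_join (vec.span {e}) (V \<inter> hyp) \<subseteq> V"
      unfolding proj_join_def using V e(1) by (intro vec.span_minimal) (auto simp: span_subset_iff)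
    ultimately show "x \<in> V" by blast
  next
    fix x assume "x \<in> V"
    then obtain k where "x - k *s e \<in> V \<inter> hyp" using e by blast
    moreover have "k *s e \<in> vec.span {e}" by (simp add: vec.span_base vec.span_scale)
    moreover have "x = k *s e + (x - k *s e)" by simp
    ultimately show "x \<in> proj_join (vec.span {e}) (V \<inter> hyp)"
      unfolding proj_join_iff[OF vec.subspace_span vec.subspace_inter[OF V subspace_hyp]] by blast
  qed
  have join1: "proj_join p1 l1 = W" unfolding p1_def l1_def by (rule join[OF subspace_W h1(5,8)])
  have join2: "proj_join p2 l2 = W'" unfolding p2_def l2_def by (rule join[OF subspace_W' h2(5,8)])
  \<comment> \<open>Here \<open>a\<close> lies in \<open>S\<close> and the span of \<open>c\<close>
    and \<open>e\<close> in \<open>m\<close>, and \<open>l\<close> is nondegenerate. This is the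
    hypothesis under which \<open>collineation_eq_sig\<close> determines the images of
    \<open>p1\<close> and \<open>p2\<close>.\<close>
  have not_span: "a \<notin> vec.span {c, e}" if l: "external_line l" and a: "a \<in> l" "a \<noteq> 0" "l \<subseteq> S"
    and e: "e \<in> m" for a e l
  proof
    assume "a \<in> vec.span {c, e}"
    moreover have "vec.span {c, e} \<subseteq> m" using c_m e by (intro vec.span_minimal subspace_perp) auto
    ultimately have "a \<in> m" by blast
    then show False using external_line_nondegenerate[OF l a(1)] a m_orth by blast
  qed
  have fu: "f (a1 + e1) = 0" "f (a2 + e2) = 0" using T T' h1(2) h2(2) by (auto simp: triad_def)
  have a: "a1 \<in> l1" "a2 \<in> l2" using h1(3) h2(3) by (auto simp: l1_def l2_def)
  have \<sigma>1: "\<sigma> p1 = sig p1" unfolding p1_def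
    using collineation_eq_sig[OF coll \<sigma>_X h1(6) _ h1(4) not_span[OF l1 a(1) h1(4) l1_S e_m(1)] fu(1)]
      a l_hyp by blast
  have \<sigma>2: "\<sigma> p2 = sig p2" unfolding p2_def
    using collineation_eq_sig[OF coll \<sigma>_X h2(6) _ h2(4) not_span[OF l2 a(2) h2(4) l2_S e_m(2)] fu(2)]
      a l_hyp by blast
  have join3: "proj_join (\<sigma> p1) l1 = reflect ` W"
    unfolding \<sigma>1 join1[symmetric] by (rule proj_join_sig) (simp_all add: p1_def l_hyp(1) subspace_l1 sig_span)
  have join4: "proj_join (\<sigma> p2) l2 = reflect ` W'"
    unfolding \<sigma>2 join2[symmetric] by (rule proj_join_sig) (simp_all add: p2_def l_hyp(2) subspace_l2 sig_span)
  have rW: "reflect ` W = vec.span {reflect u, reflect v, reflect w}"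
    "reflect ` W' = vec.span {reflect u', reflect v', reflect w'}"
    by (simp_all add: W_eq W'_eq reflect_span3)
  have planes: "conic_plane f W" "conic_plane f W'" "conic_plane f (reflect ` W)" "conic_plane f (reflect ` W')"
    unfolding rW unfolding W_eq W'_eq by (intro triad_conic_plane triad_reflect T T')+
  have Z: "Z = quadric_in f W \<union> quadric_in f W' \<union> quadric_in f (reflect ` W) \<union> quadric_in f (reflect ` W')"
    using Z_eq quadric_in_reflect[OF subspace_W] quadric_in_reflect[OF subspace_W'] rW by simp
  have not_c: "p1 \<noteq> vec.span {c}" "p2 \<noteq> vec.span {c}"
    unfolding p1_def p2_def
    using c_notin_W' sw.c_notin_W' h1(5) h2(5) span_subset_iff[OF subspace_W] span_subset_iff[OF subspace_W']
      vec.span_base[of c "{c}"] by blast+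
  have "proj_solid S" by (simp add: proj_subspace_def subspace_S dim_S)
  moreover have "S \<subseteq> hyp" unfolding S_def by (rule vec.span_minimal[OF _ subspace_hyp]) (use l_hyp in auto)
  moreover have "proj_line m" by (simp add: proj_subspace_def subspace_perp dim_m)
  moreover have "perp f hyp \<subseteq> m" unfolding perp_hyp by (simp add: span_subset_iff[OF subspace_perp] c_m)
  moreover have "proj_line l1" using external_line_dim[OF l1] by (simp add: proj_subspace_def subspace_l1)
  moreover have "proj_point p1" "proj_point p2" using e0 proj_point_iff p1_def p2_def by blast+
  moreover have "p1 \<subseteq> m" "p2 \<subseteq> m" unfolding p1_def p2_def using e_m by (simp_all add: span_subset_iff[OF subspace_perp])
  moreover have "p2 \<subseteq> perp f p1"
    unfolding p1_def p2_def span_subset_perp_span using W_orth h1(5) h2(5) by blast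
  moreover have "l2 = perp f l1 \<inter> S" using l2_eq by simp
  ultimately show ?thesis
    using hyp_S no_pts[OF ext_m] no_pts[OF l1] l1_S not_c planes Z
    unfolding perp_hyp
    by (intro exI[of _ S] exI[of _ l1] exI[of _ l2] exI[of _ p1] exI[of _ p2])
      (simp add: join1 join2 join3 join4)
qed

end

text \<open>The plane \<open>W\<close> is spanned by the points from \<open>exists_triad\<close>,
  and \<open>W'\<close> by three of their common neighbours \<open>A\<close>; the latter are
  pairwise non-orthogonal, being neighbours of \<open>p1\<close>. A singular point of
  \<open>W\<close> is orthogonal to all of \<open>A\<close>, hence in \<open>Z\<close>; a singular
  point of \<open>W'\<close> is then orthogonal to the whole conic in \<open>W\<close>, hence also
  in \<open>Z\<close>.\<close>

lemma (in balanced_set) exists_conic_pair: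
  "\<exists>u v w u' v' w' W W'. conic_pair f c Z u v w u' v' w' W W'"
proof -
  obtain p1 p2 p3 where p: "p1 \<in> Z" "p2 \<in> Z" "p3 \<in> Z"
      "\<not> orth p1 p2" "\<not> orth p1 p3" "\<not> orth p2 p3"
    and ge: "5 \<le> card {x \<in> Z. orth x p1 \<and> orth x p2 \<and> orth x p3}"
    using exists_triad by blast
  define A where "A = {x \<in> Z. orth x p1 \<and> orth x p2 \<and> orth x p3}"
  have rep: "\<exists>x. f x = 0 \<and> p = vec.span {x}" if "p \<in> Z" for p
    using Z_quadric[OF that] by (auto simp: in_quadric_iff)
  obtain u v w where uvw: "f u = 0" "p1 = vec.span {u}" "f v = 0" "p2 = vec.span {v}"
    "f w = 0" "p3 = vec.span {w}"
    using rep p(1-3) by meson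
  have T: "triad u v w" using p(4-6) uvw by (simp add: triad_def orth_span)
  have A_orth: "\<not> orth x y" if xy: "x \<in> A" "y \<in> A" "x \<noteq> y" for x y
  proof -
    have Z: "x \<in> Z" "y \<in> Z" using xy by (auto simp: A_def)
    have "x \<in> nbr p1" "y \<in> nbr p1"
      using xy p(1) Z orth_commute[OF Z_quadric Z_quadric] by (auto simp: A_def nbr_def)
    moreover have "x \<noteq> p1" "y \<noteq> p1" using xy p(4) by (auto simp: A_def)
    ultimately show ?thesis using nbr_not_orth p(1) xy by blast
  qed
  have cA: "card A \<ge> 5" using ge by (simp add: A_def)
  then obtain B where B: "B \<subseteq> A" "card B = 3"
    using obtain_subset_with_card_n[of 3 A] by auto
  then obtain q1 q2 q3 where q: "q1 \<in> A" "q2 \<in> A" "q3 \<in> A" "q1 \<noteq> q2" "q1 \<noteq> q3" "q2 \<noteq> q3"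
    by (auto simp: card_3_iff)
  have qZ: "q1 \<in> Z" "q2 \<in> Z" "q3 \<in> Z" using q by (auto simp: A_def)
  obtain u' v' w' where uvw': "f u' = 0" "q1 = vec.span {u'}" "f v' = 0" "q2 = vec.span {v'}"
    "f w' = 0" "q3 = vec.span {w'}"
    using rep qZ by meson
  have "\<not> orth q1 q2" "\<not> orth q1 q3" "\<not> orth q2 q3" using A_orth q by auto
  then have T': "triad u' v' w'" using uvw' by (simp add: triad_def orth_span)
  define W W' where "W = vec.span {u, v, w}" and "W' = vec.span {u', v', w'}"
  have A_perp: "r \<subseteq> perp f W" if "r \<in> A" for r
  proof -
    obtain x where x: "r = vec.span {x}" using rep \<open>r \<in> A\<close> by (auto simp: A_def)
    have "b x u = 0" "b x v = 0" "b x w = 0" using that uvw by (auto simp: A_def x orth_span)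
    then have "x \<in> perp f W" by (simp add: W_def in_perp_span_iff b_commute)
    then show ?thesis using span_subset_iff[OF subspace_perp] x by simp
  qed
  have "{u', v', w'} \<subseteq> perp f W"
    using A_perp[OF q(1)] A_perp[OF q(2)] A_perp[OF q(3)] uvw' vec.span_superset by blast
  then have "W' \<subseteq> perp f W" unfolding W'_def by (rule vec.span_minimal[OF _ subspace_perp])
  moreover have "vec.dim (perp f W) = 3" using dim_perp[of W] triad_dim[OF T] by (simp add: W_def)
  ultimately have perp_W: "perp f W = W'"
    using vec.subspace_dim_equal[of W' "perp f W"] subspace_perp triad_dim[OF T'] by (simp add: W'_def)
  have C: "quadric_in f W \<subseteq> Z"
  proof
    fix p assume p: "p \<in> quadric_in f W"
    then have "orth p r" if "r \<in> A" for r
      using A_perp[OF that] perp_antimono[of p W] by (auto simp: orth_def quadric_in_def)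
    then show "p \<in> Z" using nbr_ge_5_in_Z[of p A] p cA by (auto simp: A_def quadric_in_def)
  qed
  have C': "quadric_in f W' \<subseteq> Z"
  proof
    fix p assume p: "p \<in> quadric_in f W'"
    have "orth p r" if "r \<in> quadric_in f W" for r
    proof -
      have "orth r p" using that p perp_antimono[of r W] perp_W by (auto simp: orth_def quadric_in_def)
      then show ?thesis using orth_commute p that by (auto simp: quadric_in_def)
    qed
    moreover have "5 \<le> card (quadric_in f W)"
      using triad_conic_card[OF T] field_card by (simp add: W_def)
    ultimately show "p \<in> Z" using nbr_ge_5_in_Z[of p "quadric_in f W"] p C by (auto simp: quadric_in_def)
  qed
  have "conic_pair f c Z u v w u' v' w' W W'"
    by unfold_locales (use T T' perp_W C C' in \<open>auto simp: W_def W'_def\<close>)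
  then show ?thesis by blast
qed

section \<open>The eigenspaces\<close>

context quadric_scheme
begin

context
  fixes \<sigma> :: "('a ^ 6) set \<Rightarrow> ('a ^ 6) set"
  assumes \<sigma>: "p \<in> quadric_minus f hyp \<Longrightarrow> \<sigma> p = sig p"
begin

lemma collinear_pts_iff_orth: "collinear_pts f p r \<longleftrightarrow> p \<noteq> r \<and> orth p r"
  by (simp add: collinear_pts_def orth_def)

lemma not_collinear_both:
  assumes "p \<in> quadric_minus f hyp" "r \<in> quadric_minus f hyp"
  shows "\<not> (collinear_pts f p r \<and> collinear_pts f p (\<sigma> r))"
  using not_orth_sig'[OF assms] by (simp add: collinear_pts_iff_orth \<sigma> assms)

lemma not_collinear_image:
  assumes "p \<in> quadric_minus f hyp"
  shows "\<not> collinear_pts f p (\<sigma> p)" "\<not> collinear_pts f (\<sigma> p) p" "p \<noteq> \<sigma> p"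
proof -
  have no: "\<not> orth p (sig p)"
    using not_orth_sig'[OF assms assms] orth_refl quadric_minusD assms by blast
  moreover have "orth (sig p) p \<longleftrightarrow> orth p (sig p)"
    using orth_commute quadric_minusD assms sig_quadric_minus by blast
  ultimately show "\<not> collinear_pts f p (\<sigma> p)" "\<not> collinear_pts f (\<sigma> p) p" "p \<noteq> \<sigma> p"
    using orth_refl[OF quadric_minusD[OF assms]] assms
    by (auto simp: collinear_pts_iff_orth \<sigma>)
qed

lemma scheme_adj_3:
  assumes "p \<in> quadric_minus f hyp" "r \<in> quadric_minus f hyp"
  shows "scheme_adj f hyp \<sigma> 3 p r = of_bool (collinear_pts f p r)"
  using not_collinear_both[OF assms] assms by (auto simp: scheme_adj_def scheme_rel_def)

lemma scheme_adj_4: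
  assumes "p \<in> quadric_minus f hyp" "r \<in> quadric_minus f hyp"
  shows "scheme_adj f hyp \<sigma> 4 p r = of_bool (p = \<sigma> r)"
  using assms by (auto simp: scheme_adj_def scheme_rel_def)

text \<open>The five relations partition the pairs, so the adjacency matrices add up to the all-one
  matrix.\<close>

lemma scheme_adj_sum:
  assumes "p \<in> quadric_minus f hyp" "r \<in> quadric_minus f hyp"
  shows "(\<Sum>k\<le>4. scheme_adj f hyp \<sigma> k p r) = 1"
proof -
  let ?a = "collinear_pts f p r" and ?b = "collinear_pts f p (\<sigma> r)"
  have "(\<Sum>k\<le>4. scheme_adj f hyp \<sigma> k p r) = of_bool (p = r) + of_bool (\<not> ?a \<and> ?b)
      + of_bool (\<not> ?a \<and> \<not> ?b \<and> p \<noteq> r \<and> p \<noteq> \<sigma> r) + of_bool (?a \<and> \<not> ?b) + of_bool (p = \<sigma> r)"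
    using assms by (simp add: scheme_adj_def scheme_rel_def numeral_eq_Suc)
  moreover have "\<not> (?a \<and> ?b)" "p = r \<Longrightarrow> \<not> ?b \<and> p \<noteq> \<sigma> r" "p = \<sigma> r \<Longrightarrow> \<not> ?a"
    using not_collinear_both[OF assms] not_collinear_image[OF assms(2)] by auto
  moreover have "p = r \<Longrightarrow> \<not> ?a" "p = \<sigma> r \<Longrightarrow> \<not> ?b"
    by (simp_all add: collinear_pts_def)
  ultimately show ?thesis by (cases "p = r"; cases "p = \<sigma> r"; cases ?a; cases ?b) simp_all
qed

text \<open>The all-one matrix acts on \<open>V_i\<close> by the sum of row \<open>i\<close> of
  \<open>P\<close>. This makes vectors of \<open>V_0\<close> constant and those of
  \<open>V_2\<close> sum to 0.\<close>

lemma scheme_eigenspace_sum: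
  assumes "x \<in> scheme_eigenspace f hyp \<sigma> i" "p \<in> quadric_minus f hyp"
  shows "(\<Sum>r \<in> quadric_minus f hyp. x r) = (\<Sum>k\<le>4. scheme_P (real CARD('a)) i k) * x p"
proof -
  let ?X = "quadric_minus f hyp"
  have "(\<Sum>r\<in>?X. x r) = (\<Sum>r\<in>?X. (\<Sum>k\<le>4. scheme_adj f hyp \<sigma> k p r) * x r)"
    using assms by (intro sum.cong) (simp_all add: scheme_adj_sum)
  also have "\<dots> = (\<Sum>k\<le>4. \<Sum>r\<in>?X. scheme_adj f hyp \<sigma> k p r * x r)"
    unfolding sum_distrib_right by (rule sum.swap)
  also have "\<dots> = (\<Sum>k\<le>4. scheme_P (real CARD('a)) i k * x p)"
    using assms by (intro sum.cong) (auto simp: scheme_eigenspace_def)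
  finally show ?thesis by (simp add: sum_distrib_right)
qed

lemma balanced_set_of_eigenspaces:
  assumes q: "CARD('a) \<ge> 59" and Z: "Z \<subseteq> quadric_minus f hyp"
    and ind: "indicator Z \<in> fun_sum (scheme_eigenspace f hyp \<sigma> 0) (scheme_eigenspace f hyp \<sigma> 2)"
    and card: "card Z = 4 * (CARD('a) + 1)"
  shows "balanced_set f c Z"
proof -
  let ?X = "quadric_minus f hyp" and ?q = "real CARD('a)"
  let ?\<chi> = "indicator Z :: ('a ^ 6) set \<Rightarrow> real"
  have q59: "?q \<ge> 59" using q by simp
  obtain x y where x: "x \<in> scheme_eigenspace f hyp \<sigma> 0" and y: "y \<in> scheme_eigenspace f hyp \<sigma> 2"
    and "?\<chi> = (\<lambda>p. x p + y p)"
    using ind by (auto simp: fun_sum_def)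
  then have xy: "?\<chi> p = x p + y p" for p by metis
  have P0: "(\<Sum>k\<le>4. scheme_P ?q 0 k) = ?q\<^sup>2 * (?q\<^sup>2 - 1)"
    by (simp add: scheme_P_def numeral_eq_Suc algebra_simps)
  have P2: "(\<Sum>k\<le>4. scheme_P ?q 2 k) = 0"
    by (simp add: scheme_P_def numeral_eq_Suc)
  have "Z \<noteq> {}" using card by auto
  then obtain z where z: "z \<in> ?X" using Z by blast
  have "(\<Sum>p\<in>?X. ?\<chi> p) = 4 * (?q + 1)"
    using Z card by (simp add: indicator_def Int_absorb1)
  moreover have "(\<Sum>p\<in>?X. y p) = 0" using scheme_eigenspace_sum[OF y z] P2 by simp
  ultimately have sum_x: "(\<Sum>p\<in>?X. x p) = 4 * (?q + 1)" by (simp add: xy sum.distrib)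
  \<comment> \<open>The row sum for \<open>V_0\<close> is \<open>q^2 * (q^2 - 1)\<close>, and the
    entries of \<open>x\<close> add up to \<open>card Z\<close>; cancelling \<open>q + 1\<close>
    leaves the constant value of \<open>x\<close>.\<close>
  have x_eq: "(?q - 1) * ?q\<^sup>2 * x p = 4" if "p \<in> ?X" for p
  proof -
    have "(?q + 1) * ((?q - 1) * ?q\<^sup>2 * x p) = (?q + 1) * 4"
      using scheme_eigenspace_sum[OF x that] P0 sum_x by (simp add: power2_eq_square algebra_simps)
    moreover have "?q + 1 \<noteq> 0" using q59 by linarith
    ultimately show ?thesis by (simp only: mult_cancel_left) simp
  qed
  have adj: "(\<Sum>r\<in>?X. scheme_adj f hyp \<sigma> k p r * ?\<chi> r)
      = scheme_P ?q 0 k * x p + scheme_P ?q 2 k * y p" if "k \<le> 4" "p \<in> ?X" for k p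
  proof -
    have "(\<Sum>r\<in>?X. scheme_adj f hyp \<sigma> k p r * ?\<chi> r)
        = (\<Sum>r\<in>?X. scheme_adj f hyp \<sigma> k p r * x r) + (\<Sum>r\<in>?X. scheme_adj f hyp \<sigma> k p r * y r)"
      by (simp add: xy distrib_left sum.distrib)
    also have "\<dots> = scheme_P ?q 0 k * x p + scheme_P ?q 2 k * y p"
      using x y that by (simp add: scheme_eigenspace_def)
    finally show ?thesis .
  qed
  have sig_Z: "sig p \<in> Z" if p: "p \<in> Z" for p
  proof -
    have pX: "p \<in> ?X" and sX: "sig p \<in> ?X" using p Z sig_quadric_minus by blast+
    \<comment> \<open>\<open>A_4\<close> fixes both components of the characteristic vector. The
      single term at \<open>p\<close> is therefore a lower bound for its value at
      \<open>sig p\<close>.\<close>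
    have "scheme_adj f hyp \<sigma> 4 (sig p) p * ?\<chi> p \<le> (\<Sum>r\<in>?X. scheme_adj f hyp \<sigma> 4 (sig p) r * ?\<chi> r)"
      using pX by (intro member_le_sum) (auto simp: scheme_adj_def)
    also have "\<dots> = ?\<chi> (sig p)" using adj[of 4, OF _ sX] by (simp add: scheme_P_def xy)
    finally show ?thesis using p scheme_adj_4[OF sX pX] \<sigma>[OF pX] by (cases "sig p \<in> Z") simp_all
  qed
  have card_orth: "card {r \<in> Z. orth p r} = 4 + (if p \<in> Z then CARD('a) else 0)" if p: "p \<in> ?X" for p
  proof -
    have "(\<Sum>r\<in>?X. scheme_adj f hyp \<sigma> 3 p r * ?\<chi> r)
        = (\<Sum>r\<in>?X. of_bool (collinear_pts f p r \<and> r \<in> Z))"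
      using p by (intro sum.cong) (auto simp: scheme_adj_3)
    also have "\<dots> = real (card {r \<in> Z. collinear_pts f p r})"
      using Z by (auto intro!: arg_cong[of _ _ card] simp: Int_def)
    finally have "real (card {r \<in> Z. collinear_pts f p r})
        = (?q - 1) * (?q\<^sup>2 + 1) * x p + (?q - 1) * y p"
      using adj[of 3, OF _ p] by (simp add: scheme_P_def)
    \<comment> \<open>Splitting \<open>q^2 + 1\<close> turns the two eigenvalues into a constant
      part, equal to 4, and a multiple of the characteristic vector.\<close>
    also have "\<dots> = (?q - 1) * ?q\<^sup>2 * x p + (?q - 1) * (x p + y p)" by (simp add: algebra_simps)
    also have "\<dots> = 4 + (?q - 1) * ?\<chi> p" by (simp only: x_eq[OF p] xy)
    finally have real_card: "real (card {r \<in> Z. collinear_pts f p r}) = 4 + (?q - 1) * ?\<chi> p" .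
    show ?thesis
    proof (cases "p \<in> Z")
      case True
      \<comment> \<open>Passing from \<open>collinear_pts\<close> to \<open>orth\<close> adds
        \<open>p\<close> itself, turning \<open>4 + (q - 1)\<close> into
        \<open>4 + q\<close>.\<close>
      have "{r \<in> Z. orth p r} = insert p {r \<in> Z. collinear_pts f p r}"
        using True orth_refl[OF quadric_minusD[OF p]] by (auto simp: collinear_pts_iff_orth)
      moreover have "p \<notin> {r \<in> Z. collinear_pts f p r}" by (simp add: collinear_pts_def)
      ultimately have "card {r \<in> Z. orth p r} = Suc (card {r \<in> Z. collinear_pts f p r})"
        using card_insert_disjoint[OF finite, of p "{r \<in> Z. collinear_pts f p r}"] by metis
      then have "real (card {r \<in> Z. orth p r}) = real (4 + CARD('a))"
        using real_card True by simp
      then show ?thesis using True by (simp only: of_nat_eq_iff if_True)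
    next
      case False
      have "{r \<in> Z. orth p r} = {r \<in> Z. collinear_pts f p r}"
        using False by (auto simp: collinear_pts_iff_orth)
      then show ?thesis using real_card False by simp
    qed
  qed
  show ?thesis by unfold_locales (use Z sig_Z card card_orth q in auto)
qed

end

end

section \<open>Reduction of the geometric hypotheses to the vector \<open>c\<close> and its
  reflection\<close>

theorem theorem4p12:
  fixes f :: "'a::{field,finite} ^ 6 \<Rightarrow> 'a"
    and H :: "('a ^ 6) set"
    and \<sigma> :: "('a ^ 6) set \<Rightarrow> ('a ^ 6) set"
    and Z :: "('a ^ 6) set set"
  assumes "CARD('a) \<ge> 59"
    and "quadratic_form f" and "elliptic_on f UNIV"
    and "proj_hyperplane H" and "parabolic_on f H"
    and "quadric_involution f H \<sigma>"
    and "Z \<subseteq> quadric_minus f H"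
    and "indicator Z \<in> fun_sum (scheme_eigenspace f H \<sigma> 0) (scheme_eigenspace f H \<sigma> 2)"
    and "card Z = 4 * (CARD('a) + 1)"
  shows "\<exists>S l1 l2 p1 p2.
      proj_solid S \<and> S \<subseteq> H \<and> hyperbolic_on f S \<and>
      proj_line (perp f S) \<and> quadric_in f (perp f S) = {} \<and> perp f H \<subseteq> perp f S \<and>
      proj_line l1 \<and> l1 \<subseteq> S \<and> quadric_in f l1 = {} \<and>
      proj_point p1 \<and> p1 \<subseteq> perp f S \<and> p1 \<noteq> perp f H \<and>
      proj_point p2 \<and> p2 \<subseteq> perp f S \<and> p2 \<noteq> perp f H \<and>
      p2 \<subseteq> perp f p1 \<and>
      l2 = perp f l1 \<inter> S \<and>
      conic_plane f (proj_join p1 l1) \<and> conic_plane f (proj_join p2 l2) \<and>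
      conic_plane f (proj_join (\<sigma> p1) l1) \<and> conic_plane f (proj_join (\<sigma> p2) l2) \<and>
      Z = quadric_in f (proj_join p1 l1) \<union> quadric_in f (proj_join p2 l2) \<union>
          quadric_in f (proj_join (\<sigma> p1) l1) \<union> quadric_in f (proj_join (\<sigma> p2) l2)"
proof -
  interpret quad_form f by unfold_locales (rule assms(2))
  have dim6: "vec.dim (UNIV :: ('a ^ 6) set) = 6" by (simp only: vec_dim_card) simp
  have ts_dim: "vec.dim U \<le> 2" if U: "totally_singular f U" for U
  proof -
    have "finite {vec.dim U |U. totally_singular f U \<and> U \<subseteq> UNIV}"
      by (rule finite_subset[of _ "range vec.dim"]) auto
    then have "vec.dim U \<le> witt_index f UNIV"
      unfolding witt_index_def using U by (intro Max_ge) auto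
    then show ?thesis using assms(3) dim6 by (simp add: elliptic_on_def)
  qed
  have nonsing: "x = 0" if "f x = 0" "\<And>y. b x y = 0" for x
    using assms(3) that by (simp add: elliptic_on_def nonsingular_on_def)
  have coll: "central_collineation \<sigma> H (perp f H)"
    and pts: "\<And>p. p \<in> quadric_minus f H \<Longrightarrow>
      \<sigma> p \<noteq> p \<and> quadric_in f (proj_join (perp f H) p) = {p, \<sigma> p}"
    using assms(6) by (auto simp: quadric_involution_def)
  obtain c where c: "c \<noteq> 0" "perp f H = vec.span {c}"
    using coll proj_point_iff unfolding central_collineation_def by metis
  have subH: "vec.subspace H" using assms(4) by (simp add: proj_hyperplane_def)
  have join: "r \<in> quadric_in f (proj_join (perp f H) (vec.span {x})) \<longleftrightarrow>
      (\<exists>y. y \<in> vec.span {c, x} \<and> y \<noteq> 0 \<and> f y = 0 \<and> r = vec.span {y})" for r x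
  proof -
    have "vec.span (vec.span {c} \<union> vec.span {x}) = vec.span {c, x}"
      by (rule antisym; rule vec.span_minimal)
        (auto simp: span_subset_iff vec.span_base intro!: vec.span_mono[THEN subsetD])
    then have "proj_join (perp f H) (vec.span {x}) = vec.span {c, x}"
      by (simp add: proj_join_def c)
    then show ?thesis by (simp add: in_quadric_in_iff Bex_def)
  qed
  have "Z \<noteq> {}" using assms(9) by auto
  then obtain p where p: "p \<in> quadric_minus f H" using assms(7) by blast
  obtain x where x: "x \<noteq> 0" "f x = 0" "p = vec.span {x}"
    using p in_quadric_iff by (auto simp: quadric_minus_def)
  text \<open>If \<open>H\<^sup>\<perp>\<close> were the radical of the polar form, the line through \<open>H\<^sup>\<perp>\<close> and \<open>p\<close> would be
    tangent, contradicting the second point \<open>\<sigma> p\<close>.\<close>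
  have nondeg: "r = 0" if r: "\<And>y. b r y = 0" for r
  proof (rule ccontr)
    assume r0: "r \<noteq> 0"
    have "r \<in> perp f H" using r by (auto simp: perp_def b_commute)
    then obtain k where "r = k *s c" using c by (auto simp: vec.span_singleton)
    then have bc: "b c y = 0" for y using r[of y] r0 by (auto simp: b_simps)
    then have fc: "f c \<noteq> 0" using nonsing c by blast
    have "\<sigma> p \<in> quadric_in f (proj_join (perp f H) p)" using pts[OF p] by simp
    then obtain y where y: "\<sigma> p = vec.span {y}" "y \<in> vec.span {c, x}" "y \<noteq> 0" "f y = 0"
      unfolding x(3) join by blast
    then obtain s t where st: "y = s *s c + t *s x" by (auto simp: in_span2)
    have "s = 0" using y(4) x(2) fc bc by (simp add: st f_simps b_simps)
    then have "\<sigma> p = p" using y x st span_sing_eq_iff[OF x(1), of y] by auto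
    then show False using pts[OF p] by simp
  qed
  interpret elliptic_form f by unfold_locales (use nondeg ts_dim in auto)
  have H: "H = perp f (vec.span {c})" using perp_perp[OF subH] c(2) by simp
  \<comment> \<open>A singular \<open>c\<close> would lie in \<open>H\<close> and be orthogonal to
    all of \<open>H\<close>, contradicting the nonsingularity of the parabolic quadric.\<close>
  have fc: "f c \<noteq> 0"
  proof
    assume "f c = 0"
    then have "c \<in> H" unfolding H by (simp add: in_perp_span_iff b_self)
    moreover have "b c y = 0" if "y \<in> H" for y using that unfolding H by (simp add: in_perp_span_iff)
    ultimately show False
      using assms(5) c(1) \<open>f c = 0\<close> by (auto simp: parabolic_on_def nonsingular_on_def)
  qed
  interpret quadric_scheme f c by unfold_locales (rule fc)
  have H_hyp: "H = hyp" by (simp only: H hyp_eq_perp)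
  \<comment> \<open>The line through \<open>r\<close> and the centre has just the two singular
    points \<open>r\<close> and \<open>\<sigma> r\<close>; \<open>sig r\<close> is one of them and
    differs from \<open>r\<close>.\<close>
  have \<sigma>: "\<sigma> r = sig r" if r: "r \<in> quadric_minus f hyp" for r
  proof -
    obtain y where y: "y \<noteq> 0" "f y = 0" "r = vec.span {y}"
      using r in_quadric_iff by (auto simp: quadric_minus_def)
    have "reflect y \<in> vec.span {c, y}"
      unfolding reflect_def by (intro vec.span_diff vec.span_scale vec.span_base) auto
    then have "sig r \<in> quadric_in f (proj_join (perp f H) r)"
      unfolding y(3) join sig_span using y by (intro exI[of _ "reflect y"]) simp
    then have "sig r = r \<or> sig r = \<sigma> r" using pts r H_hyp by simp
    then show ?thesis using sig_neq[OF r] by simp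
  qed
  interpret balanced_set f c Z
    by (rule balanced_set_of_eigenspaces[OF \<sigma>]) (use assms(1,7,8,9) H_hyp in simp_all)
  obtain u v w u' v' w' W W' where "conic_pair f c Z u v w u' v' w' W W'"
    using exists_conic_pair by blast
  then interpret conic_pair f c Z u v w u' v' w' W W' .
  show ?thesis
    unfolding H_hyp by (rule conic_union[OF _ \<sigma>]) (use coll c(2) H_hyp in simp_all)
qed

end
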